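(* Let $E,A_1,A_2$ be separable Banach lattices, and let $f_1:E\to A_1$ and $f_2:E\to A_2$ be embeddings. Then there exist a separable Banach lattice $G$ and embeddings $g_1:A_1\to G$ and $g_2:A_2\to G$ such that $g_1\circ f_1=g_2\circ f_2$.
   Context: All Banach lattices are real. An embedding between Banach lattices is a linear map that preserves the lattice operations and the norm (an isometric lattice homomorphism, not necessarily onto). *)

theory Defs
  imports "HOL-Analysis.Analysis" "HOL-Algebra.Module" "HOL-Algebra.Lattice"
begin

text \<open>
  Banach lattices are treated as structures with an explicit carrier set, so that a statement
  can assert the existence of one.  The vector space part reuses the modules of HOL-Algebra,
  over the ring of real numbers; the record fields \<open>mult\<close> and \<open>one\<close> that a
  module inherits from the ring record are not used.
\<close>

definition real_ring :: "real ring" where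
  "real_ring = \<lparr>carrier = UNIV, mult = (*), one = 1, zero = 0, add = (+)\<rparr>"

record 'a normed_lattice = "(real, 'a) module" +
  leq :: "'a \<Rightarrow> 'a \<Rightarrow> bool"  (infix \<open>\<preceq>\<index>\<close> 50)
  nrm :: "'a \<Rightarrow> real"

definition order_of :: "'a normed_lattice \<Rightarrow> 'a gorder" where
  "order_of V = \<lparr>carrier = carrier V, eq = (=), le = leq V\<rparr>"

definition modulus :: "'a normed_lattice \<Rightarrow> 'a \<Rightarrow> 'a" where
  "modulus V x = x \<squnion>\<^bsub>order_of V\<^esub> (\<ominus>\<^bsub>V\<^esub> x)"

text \<open>
  The locale \<^locale>\<open>Metric_space\<close> constrains distances also outside the carrier;
  hence the value 0 there.
\<close>

definition nrm_dist :: "'a normed_lattice \<Rightarrow> 'a \<Rightarrow> 'a \<Rightarrow> real" where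
  "nrm_dist V x y =
     (if x \<in> carrier V \<and> y \<in> carrier V then nrm V (x \<ominus>\<^bsub>V\<^esub> y) else 0)"

locale vector_lattice = module real_ring V + ord: Lattice.lattice "order_of V"
  for V :: "'a normed_lattice" (structure) +
  assumes leq_add:
      "\<lbrakk>x \<in> carrier V; y \<in> carrier V; z \<in> carrier V; x \<preceq> y\<rbrakk> \<Longrightarrow> x \<oplus> z \<preceq> y \<oplus> z"
    and leq_smult:
      "\<lbrakk>x \<in> carrier V; y \<in> carrier V; 0 \<le> a; x \<preceq> y\<rbrakk> \<Longrightarrow> a \<odot> x \<preceq> a \<odot> y"

locale normed_vector_lattice = vector_lattice +
  assumes nrm_nonneg: "x \<in> carrier V \<Longrightarrow> 0 \<le> nrm V x"
    and nrm_eq_0: "x \<in> carrier V \<Longrightarrow> nrm V x = 0 \<longleftrightarrow> x = \<zero>"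
    and nrm_smult: "x \<in> carrier V \<Longrightarrow> nrm V (a \<odot> x) = \<bar>a\<bar> * nrm V x"
    and nrm_triangle:
      "\<lbrakk>x \<in> carrier V; y \<in> carrier V\<rbrakk> \<Longrightarrow> nrm V (x \<oplus> y) \<le> nrm V x + nrm V y"
    and nrm_mono:
      "\<lbrakk>x \<in> carrier V; y \<in> carrier V; modulus V x \<preceq> modulus V y\<rbrakk> \<Longrightarrow> nrm V x \<le> nrm V y"

lemma (in normed_vector_lattice) Metric_space_nrm_dist:
  "Metric_space (carrier V) (nrm_dist V)"
proof
  show "0 \<le> nrm_dist V x y" for x y
    by (simp add: nrm_dist_def nrm_nonneg)
  show "nrm_dist V x y = nrm_dist V y x" for x y
  proof (cases "x \<in> carrier V \<and> y \<in> carrier V")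
    case True
    have one: "carrier real_ring = UNIV" "\<one>\<^bsub>real_ring\<^esub> = 1"
      by (simp_all add: real_ring_def)
    have m1: "\<ominus>\<^bsub>real_ring\<^esub> 1 = (-1::real)"
      using R.minus_equality[of "-1" 1] by (simp add: real_ring_def)
    have "x \<ominus> y = \<ominus> (y \<ominus> x)"
      using True by (simp add: M.minus_add a_minus_def M.a_comm)
    also have "\<dots> = (-1) \<odot> (y \<ominus> x)"
      using smult_l_minus[of 1 "y \<ominus> x"] smult_one[of "y \<ominus> x"] True by (simp add: one m1)
    finally have "nrm V (x \<ominus> y) = nrm V (y \<ominus> x)"
      using nrm_smult[of "y \<ominus> x" "-1"] True by simp
    then show ?thesis using True by (simp add: nrm_dist_def)
  qed (auto simp: nrm_dist_def)
  show "nrm_dist V x y = 0 \<longleftrightarrow> x = y" if "x \<in> carrier V" "y \<in> carrier V" for x y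
    using that M.add.inv_solve_right[of \<zero> x y]
    by (auto simp: nrm_dist_def nrm_eq_0 a_minus_def)
  show "nrm_dist V x z \<le> nrm_dist V x y + nrm_dist V y z"
    if "x \<in> carrier V" "y \<in> carrier V" "z \<in> carrier V" for x y z
  proof -
    have "(x \<ominus> y) \<oplus> (y \<ominus> z) = x \<oplus> (\<ominus> y \<oplus> y) \<oplus> \<ominus> z"
      using that by (simp add: a_minus_def M.a_assoc)
    also have "\<dots> = x \<ominus> z"
      using that by (simp add: a_minus_def M.l_neg)
    finally show ?thesis
      using nrm_triangle[of "x \<ominus> y" "y \<ominus> z"] that by (simp add: nrm_dist_def)
  qed
qed

locale banach_lattice = normed_vector_lattice +
  assumes complete: "Metric_space.mcomplete (carrier V) (nrm_dist V)"

locale separable_banach_lattice = banach_lattice +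
  assumes separable: "separable_space (Metric_space.mtopology (carrier V) (nrm_dist V))"

definition lattice_embedding ::
    "'a normed_lattice \<Rightarrow> 'b normed_lattice \<Rightarrow> ('a \<Rightarrow> 'b) \<Rightarrow> bool" where
  "lattice_embedding A B f \<longleftrightarrow>
     f \<in> carrier A \<rightarrow> carrier B \<and>
     (\<forall>x\<in>carrier A. \<forall>y\<in>carrier A. f (x \<oplus>\<^bsub>A\<^esub> y) = f x \<oplus>\<^bsub>B\<^esub> f y) \<and>
     (\<forall>a. \<forall>x\<in>carrier A. f (a \<odot>\<^bsub>A\<^esub> x) = a \<odot>\<^bsub>B\<^esub> f x) \<and>
     (\<forall>x\<in>carrier A. \<forall>y\<in>carrier A.
        f (x \<squnion>\<^bsub>order_of A\<^esub> y) = f x \<squnion>\<^bsub>order_of B\<^esub> f y) \<and>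
     (\<forall>x\<in>carrier A. \<forall>y\<in>carrier A.
        f (x \<sqinter>\<^bsub>order_of A\<^esub> y) = f x \<sqinter>\<^bsub>order_of B\<^esub> f y) \<and>
     (\<forall>x\<in>carrier A. nrm B (f x) = nrm A x)"

text \<open>
  Separable Banach lattices have at most the cardinality of the continuum.  The following
  shows that each of them has an isomorphic copy whose elements are of type
  \<^typ>\<open>nat \<Rightarrow> real\<close>, so that asserting the existence of a separable Banach lattice
  over this type is no restriction.
\<close>

definition lattice_copy :: "('a \<Rightarrow> 'b) \<Rightarrow> 'a normed_lattice \<Rightarrow> 'b normed_lattice" where
  "lattice_copy h V = (let g = inv_into (carrier V) h in
     \<lparr>carrier = h ` carrier V, mult = (\<lambda>x y. x), one = h \<zero>\<^bsub>V\<^esub>, zero = h \<zero>\<^bsub>V\<^esub>,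
      add = (\<lambda>x y. h (g x \<oplus>\<^bsub>V\<^esub> g y)), smult = (\<lambda>a x. h (a \<odot>\<^bsub>V\<^esub> g x)),
      leq = (\<lambda>x y. leq V (g x) (g y)), nrm = (\<lambda>x. nrm V (g x))\<rparr>)"

lemma carrier_copy: "carrier (lattice_copy h V) = h ` carrier V"
  by (simp add: lattice_copy_def Let_def)

context
  fixes V :: "'a normed_lattice" and h :: "'a \<Rightarrow> 'b"
  assumes V: "separable_banach_lattice V" and h: "inj_on h (carrier V)"
begin

interpretation V: separable_banach_lattice V by (rule V)

private abbreviation W where "W \<equiv> lattice_copy h V"

private lemma W_simps:
  "carrier W = h ` carrier V" "\<zero>\<^bsub>W\<^esub> = h \<zero>\<^bsub>V\<^esub>"
  "x \<in> carrier V \<Longrightarrow> y \<in> carrier V \<Longrightarrow> h x \<oplus>\<^bsub>W\<^esub> h y = h (x \<oplus>\<^bsub>V\<^esub> y)"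
  "x \<in> carrier V \<Longrightarrow> a \<odot>\<^bsub>W\<^esub> h x = h (a \<odot>\<^bsub>V\<^esub> x)"
  "x \<in> carrier V \<Longrightarrow> y \<in> carrier V \<Longrightarrow> leq W (h x) (h y) = leq V x y"
  "x \<in> carrier V \<Longrightarrow> nrm W (h x) = nrm V x"
  by (simp_all add: lattice_copy_def Let_def h)

private lemma RV: "carrier real_ring = UNIV" by (simp add: real_ring_def)

private lemma V_smult_closed: "x \<in> carrier V \<Longrightarrow> a \<odot>\<^bsub>V\<^esub> x \<in> carrier V"
  by (simp add: RV)

private lemma W_ab: "abelian_group W"
proof (rule abelian_groupI)
  fix x assume "x \<in> carrier W"
  then obtain u where u: "u \<in> carrier V" "x = h u" by (auto simp: W_simps)
  then show "\<exists>y\<in>carrier W. y \<oplus>\<^bsub>W\<^esub> x = \<zero>\<^bsub>W\<^esub>"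
    by (intro bexI[of _ "h (\<ominus>\<^bsub>V\<^esub> u)"]) (auto simp: W_simps V.M.l_neg)
qed (auto simp: W_simps V.M.a_ac)

private lemma W_mod: "module real_ring W"
proof (rule moduleI)
  show "cring real_ring" by (rule V.R.is_cring)
qed (use W_ab in \<open>auto simp: W_simps RV V.smult_l_distr V.smult_r_distr V.smult_assoc1 V_smult_closed\<close>)

private lemma W_minus: "x \<in> carrier V \<Longrightarrow> \<ominus>\<^bsub>W\<^esub> h x = h (\<ominus>\<^bsub>V\<^esub> x)"
  using abelian_group.minus_equality[OF W_ab, of "h (\<ominus>\<^bsub>V\<^esub> x)" "h x"]
  by (simp add: W_simps V.M.l_neg)

private lemma oW: "carrier (order_of W) = h ` carrier V" "eq (order_of W) = (=)"
  "le (order_of W) = leq W"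
  by (simp_all add: order_of_def W_simps)

private lemma oV: "carrier (order_of V) = carrier V" "eq (order_of V) = (=)"
  "le (order_of V) = leq V"
  by (simp_all add: order_of_def)

private lemma least_iff: "x \<in> carrier L \<Longrightarrow> y \<in> carrier L \<Longrightarrow> least L s (Upper L {x, y}) \<longleftrightarrow>
   s \<in> carrier L \<and> le L x s \<and> le L y s \<and>
   (\<forall>u\<in>carrier L. le L x u \<longrightarrow> le L y u \<longrightarrow> le L s u)"
  unfolding least_def Upper_def by auto

private lemma greatest_iff: "x \<in> carrier L \<Longrightarrow> y \<in> carrier L \<Longrightarrow> greatest L s (Lower L {x, y}) \<longleftrightarrow>
   s \<in> carrier L \<and> le L s x \<and> le L s y \<and>
   (\<forall>u\<in>carrier L. le L u x \<longrightarrow> le L u y \<longrightarrow> le L u s)"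
  unfolding greatest_def Lower_def by auto

private lemma least_W: "x \<in> carrier V \<Longrightarrow> y \<in> carrier V \<Longrightarrow> s \<in> carrier V \<Longrightarrow>
   least (order_of W) (h s) (Upper (order_of W) {h x, h y}) \<longleftrightarrow>
   least (order_of V) s (Upper (order_of V) {x, y})"
  by (simp add: least_iff oW oV W_simps)

private lemma greatest_W: "x \<in> carrier V \<Longrightarrow> y \<in> carrier V \<Longrightarrow> s \<in> carrier V \<Longrightarrow>
   greatest (order_of W) (h s) (Lower (order_of W) {h x, h y}) \<longleftrightarrow>
   greatest (order_of V) s (Lower (order_of V) {x, y})"
  by (simp add: greatest_iff oW oV W_simps)

private lemma W_lat: "Lattice.lattice (order_of W)"
proof
  show "\<exists>s. least (order_of W) s (Upper (order_of W) {x, y})"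
    if "x \<in> carrier (order_of W)" "y \<in> carrier (order_of W)" for x y
  proof -
    from that obtain u v where uv: "u \<in> carrier V" "x = h u" "v \<in> carrier V" "y = h v"
      by (auto simp: oW)
    with V.ord.sup_of_two_exists[of u v] obtain s
      where s: "least (order_of V) s (Upper (order_of V) {u, v})" by (auto simp: oV)
    then have "s \<in> carrier V" using least_mem Upper_closed oV by (metis subsetD)
    then show ?thesis using s uv least_W by blast
  qed
  show "\<exists>s. greatest (order_of W) s (Lower (order_of W) {x, y})"
    if "x \<in> carrier (order_of W)" "y \<in> carrier (order_of W)" for x y
  proof -
    from that obtain u v where uv: "u \<in> carrier V" "x = h u" "v \<in> carrier V" "y = h v"
      by (auto simp: oW)
    with V.ord.inf_of_two_exists[of u v] obtain s
      where s: "greatest (order_of V) s (Lower (order_of V) {u, v})" by (auto simp: oV)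
    then have "s \<in> carrier V" using greatest_mem Lower_closed oV by (metis subsetD)
    then show ?thesis using s uv greatest_W by blast
  qed
next
  fix x y assume xy: "x \<in> carrier (order_of W)" "y \<in> carrier (order_of W)"
  show "x .=\<^bsub>order_of W\<^esub> x" by (simp add: oW)
  show "x \<sqsubseteq>\<^bsub>order_of W\<^esub> x" using xy V.ord.le_refl by (auto simp: oW oV W_simps)
  show "y .=\<^bsub>order_of W\<^esub> x" if "x .=\<^bsub>order_of W\<^esub> y" using that by (simp add: oW)
  show "x .=\<^bsub>order_of W\<^esub> y" if "x \<sqsubseteq>\<^bsub>order_of W\<^esub> y" "y \<sqsubseteq>\<^bsub>order_of W\<^esub> x"
    using xy that V.ord.weak_le_antisym by (fastforce simp: oW oV W_simps)
  fix z assume z: "z \<in> carrier (order_of W)"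
  show "x .=\<^bsub>order_of W\<^esub> z" if "x .=\<^bsub>order_of W\<^esub> y" "y .=\<^bsub>order_of W\<^esub> z"
    using that by (simp add: oW)
  show "x \<sqsubseteq>\<^bsub>order_of W\<^esub> z" if "x \<sqsubseteq>\<^bsub>order_of W\<^esub> y" "y \<sqsubseteq>\<^bsub>order_of W\<^esub> z"
    using xy z that V.ord.le_trans by (auto simp: oW oV W_simps)
qed (auto simp: oW)

interpretation WL: Lattice.lattice "order_of W" by (rule W_lat)

private lemma V_join_closed: "x \<in> carrier V \<Longrightarrow> y \<in> carrier V \<Longrightarrow> x \<squnion>\<^bsub>order_of V\<^esub> y \<in> carrier V"
  using V.ord.join_closed by (simp add: oV)

private lemma W_join: "x \<in> carrier V \<Longrightarrow> y \<in> carrier V \<Longrightarrow>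
    h x \<squnion>\<^bsub>order_of W\<^esub> h y = h (x \<squnion>\<^bsub>order_of V\<^esub> y)"
proof -
  assume xy: "x \<in> carrier V" "y \<in> carrier V"
  have l: "least (order_of V) (x \<squnion>\<^bsub>order_of V\<^esub> y) (Upper (order_of V) {x, y})"
    by (rule V.ord.joinI) (auto simp: oV xy)
  have m: "least (order_of W) (h x \<squnion>\<^bsub>order_of W\<^esub> h y) (Upper (order_of W) {h x, h y})"
    by (rule WL.joinI) (auto simp: oW xy)
  from l have "least (order_of W) (h (x \<squnion>\<^bsub>order_of V\<^esub> y)) (Upper (order_of W) {h x, h y})"
    using least_W[OF xy V_join_closed[OF xy]] by simp
  with m show ?thesis using WL.least_unique by blast
qed

private lemma W_meet: "x \<in> carrier V \<Longrightarrow> y \<in> carrier V \<Longrightarrow>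
    h x \<sqinter>\<^bsub>order_of W\<^esub> h y = h (x \<sqinter>\<^bsub>order_of V\<^esub> y)"
proof -
  assume xy: "x \<in> carrier V" "y \<in> carrier V"
  have l: "greatest (order_of V) (x \<sqinter>\<^bsub>order_of V\<^esub> y) (Lower (order_of V) {x, y})"
    by (rule V.ord.meetI) (auto simp: oV xy)
  have c: "x \<sqinter>\<^bsub>order_of V\<^esub> y \<in> carrier V" using V.ord.meet_closed xy by (simp add: oV)
  have m: "greatest (order_of W) (h x \<sqinter>\<^bsub>order_of W\<^esub> h y) (Lower (order_of W) {h x, h y})"
    by (rule WL.meetI) (auto simp: oW xy)
  from l have "greatest (order_of W) (h (x \<sqinter>\<^bsub>order_of V\<^esub> y)) (Lower (order_of W) {h x, h y})"
    using greatest_W[OF xy c] by simp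
  with m show ?thesis using WL.greatest_unique by blast
qed

private lemma W_mod_h: "x \<in> carrier V \<Longrightarrow> modulus W (h x) = h (modulus V x)"
  by (simp add: modulus_def W_minus W_join)

private lemma V_modulus_closed: "x \<in> carrier V \<Longrightarrow> modulus V x \<in> carrier V"
  by (simp add: modulus_def V_join_closed)

private lemma W_nvl: "normed_vector_lattice W"
proof (intro normed_vector_lattice.intro vector_lattice.intro W_mod W_lat)
  show "vector_lattice_axioms W"
    unfolding vector_lattice_axioms_def
    by (auto simp: W_simps V_smult_closed V.leq_add V.leq_smult)
  have "x = \<zero>\<^bsub>V\<^esub>" if "h x = h \<zero>\<^bsub>V\<^esub>" "x \<in> carrier V" for x
    using that h by (simp add: inj_on_eq_iff)
  then show "normed_vector_lattice_axioms W"
    unfolding normed_vector_lattice_axioms_def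
    by (auto simp: W_simps V_smult_closed W_mod_h V_modulus_closed V.nrm_nonneg V.nrm_eq_0 V.nrm_smult V.nrm_triangle
      intro: V.nrm_mono)
qed

private lemma W_dist: "x \<in> carrier V \<Longrightarrow> y \<in> carrier V \<Longrightarrow> nrm_dist W (h x) (h y) = nrm_dist V x y"
  by (auto simp: nrm_dist_def a_minus_def W_minus W_simps)

interpretation MV: Metric_space "carrier V" "nrm_dist V" by (rule V.Metric_space_nrm_dist)

interpretation MW: Metric_space "carrier W" "nrm_dist W"
  by (rule normed_vector_lattice.Metric_space_nrm_dist[OF W_nvl])

lemma lattice_embedding_copy: "lattice_embedding V W h"
  by (simp add: lattice_embedding_def W_simps W_join W_meet V_smult_closed)

private lemma W_in: "x \<in> carrier V \<Longrightarrow> h x \<in> carrier W"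
  by (simp add: W_simps)

private lemma W_lim:
  assumes "range s \<subseteq> carrier V" "limitin MV.mtopology s x sequentially"
  shows "limitin MW.mtopology (h \<circ> s) (h x) sequentially"
  using assms unfolding MV.limitin_metric MW.limitin_metric
  by (auto simp: W_in W_dist elim!: allE eventually_mono)

private lemma W_complete: "MW.mcomplete"
  unfolding MW.mcomplete_def
proof (intro allI impI)
  fix s assume s: "MW.MCauchy s"
  then have "range s \<subseteq> carrier W" by (simp add: MW.MCauchy_def)
  then have "range s \<subseteq> h ` carrier V" by (simp only: W_simps(1))
  then have "\<forall>n. \<exists>u. u \<in> carrier V \<and> s n = h u" by blast
  then obtain t where t: "\<And>n. t n \<in> carrier V" "\<And>n. s n = h (t n)" by metis
  have "MV.MCauchy t" using s t by (auto simp: MW.MCauchy_def MV.MCauchy_def W_dist)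
  then obtain x where "limitin MV.mtopology t x sequentially"
    using V.complete MV.mcomplete_def by blast
  then have "limitin MW.mtopology (h \<circ> t) (h x) sequentially" using t by (intro W_lim) auto
  then show "\<exists>x. limitin MW.mtopology s x sequentially" by (metis t(2) comp_apply ext)
qed

private lemma W_sep: "separable_space MW.mtopology"
proof -
  from V.separable obtain D where D: "countable D" "D \<subseteq> carrier V"
    "(MV.mtopology closure_of D) = carrier V"
    unfolding separable_space_def by auto
  have "h x \<in> (MW.mtopology closure_of (h ` D))" if x: "x \<in> carrier V" for x
  proof -
    have "x \<in> (MV.mtopology closure_of D)" using D x by simp
    then have "\<forall>r>0. \<exists>y\<in>D. y \<in> carrier V \<and> nrm_dist V x y < r"
      unfolding MV.metric_closure_of by auto
    then show ?thesis unfolding MW.metric_closure_of using x W_in W_dist by fastforce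
  qed
  then have "carrier W \<subseteq> (MW.mtopology closure_of (h ` D))" unfolding W_simps(1) by blast
  moreover have "(MW.mtopology closure_of (h ` D)) \<subseteq> carrier W"
    using closure_of_subset_topspace[of MW.mtopology] by simp
  moreover have "h ` D \<subseteq> carrier W" using D W_in by blast
  ultimately show ?thesis unfolding separable_space_def using D(1) by (intro exI[of _ "h ` D"]) auto
qed

lemma separable_banach_lattice_copy: "separable_banach_lattice W"
  using W_nvl W_complete W_sep
  by (simp add: separable_banach_lattice_def banach_lattice_def banach_lattice_axioms_def
     separable_banach_lattice_axioms_def)

end

lemma ex_copy_nat_fun:
  assumes V: "separable_banach_lattice (V :: 'a normed_lattice)"
  shows "\<exists>(W :: (nat \<Rightarrow> real) normed_lattice) h.
     separable_banach_lattice W \<and> lattice_embedding V W h \<and> h ` carrier V = carrier W"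
proof -
  interpret V: separable_banach_lattice V by (rule V)
  interpret MV: Metric_space "carrier V" "nrm_dist V" by (rule V.Metric_space_nrm_dist)
  from V.separable obtain D where D: "countable D" "D \<subseteq> carrier V"
    "(MV.mtopology closure_of D) = carrier V"
    unfolding separable_space_def by auto
  have "D \<noteq> {}" using D(3) V.M.zero_closed by (metis closure_of_empty empty_iff)
  define h where "h x n = nrm_dist V x (from_nat_into D n)" for x n
  have "inj_on h (carrier V)"
  proof (rule inj_onI)
    fix x y assume xy: "x \<in> carrier V" "y \<in> carrier V" "h x = h y"
    then have eq: "nrm_dist V x d = nrm_dist V y d" if "d \<in> D" for d
      using from_nat_into_surj[OF D(1) that] by (metis h_def)
    have "nrm_dist V x y < e" if "e > 0" for e
    proof -
      have "x \<in> (MV.mtopology closure_of D)" using D xy by simp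
      with \<open>e > 0\<close> obtain d where d: "d \<in> D" "nrm_dist V x d < e / 2"
        unfolding MV.metric_closure_of using half_gt_zero[OF \<open>e > 0\<close>] by fastforce
      then have "nrm_dist V x y \<le> nrm_dist V x d + nrm_dist V d y"
        using MV.triangle xy D by blast
      then show ?thesis using d eq[OF d(1)] MV.commute[of d y] by linarith
    qed
    then have "nrm_dist V x y \<le> 0" by (metis less_irrefl not_le)
    then show "x = y" using MV.zero[OF xy(1,2)] MV.nonneg[of x y] by linarith
  qed
  then show ?thesis
    using separable_banach_lattice_copy[OF V] lattice_embedding_copy[OF V]
    by (metis carrier_copy)
qed

end

theory Submission
  imports Defs
begin

text \<open>
  Let \<open>\<phi>\<^sub>1\<close>, \<open>\<phi>\<^sub>2\<close> be positive functionals on \<open>A1\<close>, \<open>A2\<close> that agree on \<open>E\<close>.  If \<open>\<phi>\<^sub>1\<close> is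
  split into two positive summands, Hahn--Banach extends the restrictions of the summands to \<open>E\<close>
  to a splitting of \<open>\<phi>\<^sub>2\<close>, and vice versa.  Splitting along the sign of each member of a countable
  dense subset of \<open>A1\<close> and \<open>A2\<close> in turn gives a binary tree of compatible pairs of functionals.
  An element \<open>x\<close> of \<open>A1\<close> or \<open>A2\<close> is sent to the function with value \<open>\<phi> x\<close> at the node \<open>\<phi>\<close> of the
  tree.  Under the limit superior of the \<open>\<ell>\<^sup>1\<close>-norms over the levels of the tree, this map respects
  positive parts and has norm \<open>\<phi> \<bar>x\<bar>\<close> for the root \<open>\<phi>\<close>.  Countably many trees, whose roots norm
  the elements of the dense set, make it isometric; it identifies \<open>f1 e\<close> with \<open>f2 e\<close> because the
  functionals in a pair agree on \<open>E\<close>.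
\<close>

section \<open>The Hahn--Banach theorem on modules over the reals\<close>

text \<open>Real-valued lattice homomorphisms would embed a Banach lattice into a function lattice,
  but \<open>L^p[0,1]\<close> with 1 \<le> p < \<infinity> has no nonzero one. Positive functionals
  are plentiful and extend along embeddings, yet they do not respect positive parts. The tree
  repairs this only asymptotically: at a given dense vector the defect vanishes from some level on.
  Hence the limit superior, which ignores any finite set of levels. At level \<open>n\<close> only
  the trees with index \<open>m \<le> n\<close> count, so each level norm is a finite maximum and
  still every tree enters eventually. The functions with bounded level norms, modulo null functions,
  form a Banach lattice, but in general not a separable one. Therefore \<open>G\<close> is a copy of
  a smaller lattice: the closure of the countably many lattice terms, with rational coefficients, in
  the images of the dense vectors. All maps involved are continuous, so exactness at dense vectors
  suffices.\<close>

definition pos_part :: "'a normed_lattice \<Rightarrow> 'a \<Rightarrow> 'a" where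
  "pos_part V x = x \<squnion>\<^bsub>order_of V\<^esub> \<zero>\<^bsub>V\<^esub>"

definition linear_fun :: "'a normed_lattice \<Rightarrow> ('a \<Rightarrow> real) \<Rightarrow> bool" where
  "linear_fun V f \<longleftrightarrow>
     (\<forall>x\<in>carrier V. \<forall>y\<in>carrier V. f (x \<oplus>\<^bsub>V\<^esub> y) = f x + f y) \<and>
     (\<forall>a. \<forall>x\<in>carrier V. f (a \<odot>\<^bsub>V\<^esub> x) = a * f x)"

definition pos_fun :: "'a normed_lattice \<Rightarrow> ('a \<Rightarrow> real) \<Rightarrow> bool" where
  "pos_fun V f \<longleftrightarrow> linear_fun V f \<and> (\<forall>x\<in>carrier V. leq V \<zero>\<^bsub>V\<^esub> x \<longrightarrow> 0 \<le> f x)"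

definition sublinear :: "'a normed_lattice \<Rightarrow> ('a \<Rightarrow> real) \<Rightarrow> bool" where
  "sublinear V p \<longleftrightarrow>
     (\<forall>x\<in>carrier V. \<forall>y\<in>carrier V. p (x \<oplus>\<^bsub>V\<^esub> y) \<le> p x + p y) \<and>
     (\<forall>a\<ge>0. \<forall>x\<in>carrier V. p (a \<odot>\<^bsub>V\<^esub> x) = a * p x)"

context vector_lattice
begin

lemma real_ring_simps [simp]:
  "carrier real_ring = UNIV" "\<one>\<^bsub>real_ring\<^esub> = 1" "\<zero>\<^bsub>real_ring\<^esub> = 0"
  "x \<oplus>\<^bsub>real_ring\<^esub> y = x + y" "x \<otimes>\<^bsub>real_ring\<^esub> y = x * y"
  by (simp_all add: real_ring_def)

lemma uminus_real_ring [simp]: "\<ominus>\<^bsub>real_ring\<^esub> x = - x"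
  using R.minus_equality[of "-x" x] by simp

lemma scale_closed [simp, intro]: "x \<in> carrier V \<Longrightarrow> a \<odot> x \<in> carrier V"
  by simp

lemma scale_one [simp]: "x \<in> carrier V \<Longrightarrow> 1 \<odot> x = x"
  using smult_one by simp

lemma scale_scale [simp]: "x \<in> carrier V \<Longrightarrow> a \<odot> (b \<odot> x) = (a * b) \<odot> x"
  using smult_assoc1[of a b x] by simp

lemma scale_zero [simp]: "x \<in> carrier V \<Longrightarrow> 0 \<odot> x = \<zero>" "a \<odot> \<zero> = \<zero>"
  using smult_l_null[of x] smult_r_null[of a] by auto

lemma scale_add: "x \<in> carrier V \<Longrightarrow> y \<in> carrier V \<Longrightarrow> a \<odot> (x \<oplus> y) = a \<odot> x \<oplus> a \<odot> y"
  using smult_r_distr[of a x y] by simp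

lemma add_scale: "x \<in> carrier V \<Longrightarrow> (a + b) \<odot> x = a \<odot> x \<oplus> b \<odot> x"
  using smult_l_distr[of a b x] by simp

lemma minus_eq_scale: "x \<in> carrier V \<Longrightarrow> \<ominus> x = (-1) \<odot> x"
  using smult_l_minus[of 1 x] by simp

lemma linear_fun_add: "linear_fun V f \<Longrightarrow> x \<in> carrier V \<Longrightarrow> y \<in> carrier V \<Longrightarrow> f (x \<oplus> y) = f x + f y"
  by (simp add: linear_fun_def)

lemma linear_fun_scale: "linear_fun V f \<Longrightarrow> x \<in> carrier V \<Longrightarrow> f (a \<odot> x) = a * f x"
  by (simp add: linear_fun_def)

lemma linear_fun_minus: "linear_fun V f \<Longrightarrow> x \<in> carrier V \<Longrightarrow> f (\<ominus> x) = - f x"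
  by (simp add: linear_fun_scale minus_eq_scale)

lemma linear_fun_zero: "linear_fun V f \<Longrightarrow> f \<zero> = 0"
  using linear_fun_scale[of f \<zero> 0] by simp

lemma linear_fun_diff: "linear_fun V f \<Longrightarrow> x \<in> carrier V \<Longrightarrow> y \<in> carrier V \<Longrightarrow> f (x \<ominus> y) = f x - f y"
  by (simp add: a_minus_def linear_fun_add linear_fun_minus)

lemma sublinear_add: "sublinear V p \<Longrightarrow> x \<in> carrier V \<Longrightarrow> y \<in> carrier V \<Longrightarrow> p (x \<oplus> y) \<le> p x + p y"
  by (simp add: sublinear_def)

lemma sublinear_scale: "sublinear V p \<Longrightarrow> x \<in> carrier V \<Longrightarrow> 0 \<le> a \<Longrightarrow> p (a \<odot> x) = a * p x"
  by (simp add: sublinear_def)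

lemma sublinear_zero: "sublinear V p \<Longrightarrow> p \<zero> = 0"
  using sublinear_scale[of p \<zero> 0] by simp

lemma sublinear_minus: "sublinear V p \<Longrightarrow> x \<in> carrier V \<Longrightarrow> - p (\<ominus> x) \<le> p x"
  using sublinear_add[of p x "\<ominus> x"] by (simp add: sublinear_zero M.r_neg)

text \<open>A convex cone of constraints: a pair \<open>(w, r)\<close> demands
  \<open>r \<le> f w\<close> of the functional \<open>f\<close> to be found. One format thus covers
  a prescribed lower bound at a single vector (\<open>ray\<close>) and prescribed values on a
  sublattice (\<open>wedge_graph\<close>).\<close>

definition wedge :: "('a \<times> real) set \<Rightarrow> bool" where
  "wedge W \<longleftrightarrow> W \<subseteq> carrier V \<times> UNIV \<and> (\<zero>, 0) \<in> W \<and>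
     (\<forall>x r y s. (x, r) \<in> W \<longrightarrow> (y, s) \<in> W \<longrightarrow> (x \<oplus> y, r + s) \<in> W) \<and>
     (\<forall>a x r. 0 < a \<longrightarrow> (x, r) \<in> W \<longrightarrow> (a \<odot> x, a * r) \<in> W)"

text \<open>A linear functional \<open>f\<close> below \<open>lowered p W\<close> is below \<open>p\<close> and has \<open>r \<le> f w\<close> for all \<open>(w, r) \<in> W\<close>.\<close>

definition lowered :: "('a \<Rightarrow> real) \<Rightarrow> ('a \<times> real) set \<Rightarrow> 'a \<Rightarrow> real" where
  "lowered p W x = (INF (w, r)\<in>W. p (x \<oplus> w) - r)"

text \<open>Subadditivity and \<open>r \<le> p w\<close> give p(x + w) - r \<ge> p(w) - p(-x) - r
  \<ge> -p(-x), so the infimum is over a set bounded below. Sums of constraints then yield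
  subadditivity, and positive multiples of constraints yield homogeneity.\<close>

lemma lowered:
  assumes p: "sublinear V p" and W: "wedge W" and le: "\<And>w r. (w, r) \<in> W \<Longrightarrow> r \<le> p w"
  shows lowered_sublinear: "sublinear V (lowered p W)"
    and lowered_le: "\<And>x w r. x \<in> carrier V \<Longrightarrow> (w, r) \<in> W \<Longrightarrow> lowered p W x \<le> p (x \<oplus> w) - r"
proof -
  have Wc: "w \<in> carrier V" if "(w, r) \<in> W" for w r
    using W that by (auto simp: wedge_def)
  have ne: "W \<noteq> {}" using W by (auto simp: wedge_def)
  have low: "- p (\<ominus> x) \<le> p (x \<oplus> w) - r" if "x \<in> carrier V" "(w, r) \<in> W" for x w r
  proof -
    have w: "w \<in> carrier V" using Wc that by blast
    have "\<ominus> x \<oplus> (x \<oplus> w) = w"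
      using that w by (simp add: M.r_neg1)
    then have "p w \<le> p (\<ominus> x) + p (x \<oplus> w)"
      using sublinear_add[OF p, of "\<ominus> x" "x \<oplus> w"] that w by simp
    then show ?thesis using le[OF that(2)] by linarith
  qed
  have bdd: "bdd_below ((\<lambda>(w, r). p (x \<oplus> w) - r) ` W)" if "x \<in> carrier V" for x
    using low[OF that] by (intro bdd_belowI[of _ "- p (\<ominus> x)"]) auto
  show le': "lowered p W x \<le> p (x \<oplus> w) - r" if "x \<in> carrier V" "(w, r) \<in> W" for x w r
    unfolding lowered_def using cINF_lower[OF bdd[OF that(1)] that(2)] by simp
  have ge: "c \<le> lowered p W x" if "\<And>w r. (w, r) \<in> W \<Longrightarrow> c \<le> p (x \<oplus> w) - r" for c x
    unfolding lowered_def using ne that by (intro cINF_greatest) auto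
  have sub: "lowered p W (x \<oplus> y) \<le> lowered p W x + lowered p W y"
    if x: "x \<in> carrier V" and y: "y \<in> carrier V" for x y
  proof -
    have 1: "lowered p W (x \<oplus> y) - (p (x \<oplus> v) - r) \<le> p (y \<oplus> w) - s"
      if v: "(v, r) \<in> W" and w: "(w, s) \<in> W" for v r w s
    proof -
      note c = Wc[OF v] Wc[OF w]
      have "(v \<oplus> w, r + s) \<in> W" using W v w unfolding wedge_def by blast
      then have "lowered p W (x \<oplus> y) \<le> p ((x \<oplus> y) \<oplus> (v \<oplus> w)) - (r + s)"
        using le' x y by blast
      also have "(x \<oplus> y) \<oplus> (v \<oplus> w) = (x \<oplus> v) \<oplus> (y \<oplus> w)"
        using x y c by (simp add: M.a_ac)
      also have "p \<dots> \<le> p (x \<oplus> v) + p (y \<oplus> w)"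
        using sublinear_add[OF p] x y c by simp
      finally show ?thesis by linarith
    qed
    have 2: "lowered p W (x \<oplus> y) - lowered p W y \<le> p (x \<oplus> v) - r" if v: "(v, r) \<in> W" for v r
      using ge[of "lowered p W (x \<oplus> y) - (p (x \<oplus> v) - r)" y, OF 1[OF v]] by linarith
    show ?thesis using ge[of "lowered p W (x \<oplus> y) - lowered p W y" x, OF 2] by linarith
  qed
  have le0: "lowered p W \<zero> \<le> 0"
    using le'[of \<zero> \<zero> 0] W by (simp add: wedge_def sublinear_zero[OF p])
  have ge0: "0 \<le> lowered p W \<zero>"
    by (rule ge) (use le Wc in auto)
  have hom: "lowered p W (a \<odot> x) \<le> a * lowered p W x" if a: "a > 0" and x: "x \<in> carrier V" for a x
  proof -
    have "lowered p W (a \<odot> x) / a \<le> lowered p W x"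
    proof (rule ge)
      fix w r assume w: "(w, r) \<in> W"
      then have "(a \<odot> w, a * r) \<in> W" using W a unfolding wedge_def by blast
      then have "lowered p W (a \<odot> x) \<le> p (a \<odot> x \<oplus> a \<odot> w) - a * r"
        using le' x by simp
      also have "a \<odot> x \<oplus> a \<odot> w = a \<odot> (x \<oplus> w)"
        using x Wc[OF w] by (simp add: scale_add)
      also have "p \<dots> = a * p (x \<oplus> w)"
        using sublinear_scale[OF p] x Wc[OF w] a by simp
      finally show "lowered p W (a \<odot> x) / a \<le> p (x \<oplus> w) - r"
        using a by (simp add: field_simps)
    qed
    then show ?thesis using a by (simp add: field_simps)
  qed
  have "lowered p W (a \<odot> x) = a * lowered p W x" if a: "a \<ge> 0" and x: "x \<in> carrier V" for a x
  proof (cases "a = 0")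
    case True
    then show ?thesis using le0 ge0 x by simp
  next
    case False
    then have a: "a > 0" using a by simp
    have "lowered p W (inverse a \<odot> (a \<odot> x)) \<le> inverse a * lowered p W (a \<odot> x)"
      using hom[of "inverse a" "a \<odot> x"] a x by simp
    then have "a * lowered p W x \<le> lowered p W (a \<odot> x)"
      using a x by (simp add: field_simps)
    then show ?thesis using hom[OF a x] by linarith
  qed
  then show "sublinear V (lowered p W)"
    using sub by (simp add: sublinear_def)
qed

text \<open>As constraints on a linear functional, all pairs of the ray together say no more than
  \<open>s \<le> f y\<close>; the multiples are there to make the set a wedge.\<close>

definition ray :: "'a \<Rightarrow> real \<Rightarrow> ('a \<times> real) set" where
  "ray y s = (\<lambda>t. (t \<odot> y, t * s)) ` {0..}"

lemma self_in_ray: "y \<in> carrier V \<Longrightarrow> (y, s) \<in> ray y s"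
  unfolding ray_def by (rule image_eqI[of _ _ 1]) auto

lemma wedge_ray:
  assumes y: "y \<in> carrier V"
  shows "wedge (ray y s)"
proof -
  have mem: "(t \<odot> y, t * s) \<in> ray y s" if "t \<ge> 0" for t
    unfolding ray_def by (rule imageI) (use that in simp)
  show ?thesis
    unfolding wedge_def
  proof (intro conjI allI impI)
    show "ray y s \<subseteq> carrier V \<times> UNIV" using y by (auto simp: ray_def)
    show "(\<zero>, 0) \<in> ray y s" using mem[of 0] y by simp
    fix u r v r' assume "(u, r) \<in> ray y s" "(v, r') \<in> ray y s"
    then obtain t t' where t: "t \<ge> 0" "t' \<ge> 0" "u = t \<odot> y" "r = t * s" "v = t' \<odot> y" "r' = t' * s"
      by (auto simp: ray_def)
    then show "(u \<oplus> v, r + r') \<in> ray y s"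
      using mem[of "t + t'"] y by (simp add: add_scale distrib_right)
  next
    fix a :: real and u r assume a: "0 < a" "(u, r) \<in> ray y s"
    then obtain t where t: "t \<ge> 0" "u = t \<odot> y" "r = t * s"
      by (auto simp: ray_def)
    then show "(a \<odot> u, a * r) \<in> ray y s"
      using mem[of "a * t"] y a by (simp add: mult.assoc)
  qed
qed

text \<open>Lowering \<open>q\<close> along the ray through \<open>(y, q y)\<close> gives a
  sublinear functional below \<open>q\<close>, hence \<open>q\<close> itself by minimality. Its
  value at -y is at most q(0) - q(y), so \<open>q\<close> is odd, and an odd sublinear functional is
  linear.\<close>

lemma minimal_sublinear_linear:
  assumes q: "sublinear V q"
    and min: "\<And>r. sublinear V r \<Longrightarrow> (\<forall>x\<in>carrier V. r x \<le> q x) \<Longrightarrow> \<forall>x\<in>carrier V. r x = q x"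
  shows "linear_fun V q"
proof -
  have neg: "q (\<ominus> y) = - q y" if y: "y \<in> carrier V" for y
  proof -
    let ?W = "ray y (q y)"
    note W = wedge_ray[OF y, of "q y"]
    have le: "r \<le> q w" if "(w, r) \<in> ?W" for w r
      using that y sublinear_scale[OF q y] by (auto simp: ray_def)
    have 00: "(\<zero>, 0) \<in> ?W" using W by (simp add: wedge_def)
    have "lowered q ?W x \<le> q x" if "x \<in> carrier V" for x
      using lowered_le[OF q W le that 00] that by simp
    then have eq: "lowered q ?W (\<ominus> y) = q (\<ominus> y)"
      using min[OF lowered_sublinear[OF q W le]] y by simp
    have "lowered q ?W (\<ominus> y) \<le> - q y"
      using lowered_le[OF q W le _ self_in_ray[OF y], of "\<ominus> y"] y
      by (simp add: M.l_neg sublinear_zero[OF q])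
    then show ?thesis using eq sublinear_minus[OF q y] by linarith
  qed
  have add: "q (x \<oplus> y) = q x + q y" if "x \<in> carrier V" "y \<in> carrier V" for x y
  proof -
    have "q ((x \<oplus> y) \<oplus> \<ominus> y) \<le> q (x \<oplus> y) + q (\<ominus> y)"
      using sublinear_add[OF q, of "x \<oplus> y" "\<ominus> y"] that by simp
    moreover have "(x \<oplus> y) \<oplus> \<ominus> y = x"
      using that by (simp add: M.a_assoc M.r_neg)
    ultimately show ?thesis using neg[OF that(2)] sublinear_add[OF q that] by simp
  qed
  have "q (a \<odot> x) = a * q x" if x: "x \<in> carrier V" for a x
  proof (cases "a \<ge> 0")
    case True then show ?thesis using sublinear_scale[OF q x] by simp
  next
    case False
    then have "q (\<ominus> (a \<odot> x)) = (- a) * q x"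
      using sublinear_scale[OF q x, of "-a"] x by (simp add: minus_eq_scale)
    then show ?thesis using neg[of "a \<odot> x"] x by simp
  qed
  then show ?thesis using add by (simp add: linear_fun_def)
qed

lemma ex_linear_below:
  assumes p: "sublinear V p"
  shows "\<exists>f. linear_fun V f \<and> (\<forall>x\<in>carrier V. f x \<le> p x)"
proof -
  \<comment> \<open>The value 0 outside the carrier makes comparison there trivial and keeps
    pointwise infima of chains finite everywhere. The relation \<open>?P\<close> is the reversed
    pointwise order, so the maximal element that Zorn's lemma provides is a minimal
    functional.\<close>
  let ?S = "{q. sublinear V q \<and> (\<forall>x\<in>carrier V. q x \<le> p x) \<and> (\<forall>x. x \<notin> carrier V \<longrightarrow> q x = 0)}"
  let ?P = "\<lambda>q r :: 'a \<Rightarrow> real. \<forall>x. r x \<le> q x"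
  have norm0: "(\<lambda>x. if x \<in> carrier V then q x else 0) \<in> ?S"
    if "sublinear V q" "\<forall>x\<in>carrier V. q x \<le> p x" for q
    using that by (simp add: sublinear_def)
  have "\<exists>m\<in>?S. \<forall>a\<in>?S. ?P m a \<longrightarrow> a = m"
  proof (rule predicate_Zorn)
    show "partial_order_on ?S (relation_of ?P ?S)"
      by (auto simp: partial_order_on_def preorder_on_def refl_on_def trans_def antisym_def relation_of_def
           intro!: ext antisym intro: order_trans)
    fix C assume C: "C \<in> Chains (relation_of ?P ?S)"
    show "\<exists>u\<in>?S. \<forall>a\<in>C. ?P a u"
    proof (cases "C = {}")
      case True
      then show ?thesis using norm0[OF p] by blast
    next
      case False
      have CS: "C \<subseteq> ?S"
      proof
        fix q assume "q \<in> C"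
        then have "(q, q) \<in> relation_of ?P ?S" using C unfolding Chains_def by blast
        then show "q \<in> ?S" unfolding relation_of_def by blast
      qed
      have tot: "(\<forall>x. q x \<le> r x) \<or> (\<forall>x. r x \<le> q x)" if "q \<in> C" "r \<in> C" for q r
      proof -
        have "(q, r) \<in> relation_of ?P ?S \<or> (r, q) \<in> relation_of ?P ?S"
          using C that unfolding Chains_def by blast
        then show ?thesis unfolding relation_of_def by blast
      qed
      define u where "u x = (INF q\<in>C. q x)" for x
      have bdd: "bdd_below ((\<lambda>q. q x) ` C)" for x
      proof (cases "x \<in> carrier V")
        case x: True
        have "- p (\<ominus> x) \<le> q x" if "q \<in> C" for q
        proof -
          have "sublinear V q" "q (\<ominus> x) \<le> p (\<ominus> x)" using CS that x by auto
          then show ?thesis using sublinear_minus[of q x] x by linarith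
        qed
        then show ?thesis by (intro bdd_belowI[of _ "- p (\<ominus> x)"]) auto
      next
        case False
        then have "q x = 0" if "q \<in> C" for q using CS that by auto
        then show ?thesis by (intro bdd_belowI[of _ 0]) (metis imageE order_refl)
      qed
      have lo: "u x \<le> q x" if "q \<in> C" for q x
        unfolding u_def using cINF_lower[OF bdd that] .
      have ge: "c \<le> u x" if "\<And>q. q \<in> C \<Longrightarrow> c \<le> q x" for c x
        unfolding u_def using False that by (intro cINF_greatest) auto
      have const: "u x = 0" if "\<And>q. q \<in> C \<Longrightarrow> q x = 0" for x
      proof (rule antisym)
        obtain q where "q \<in> C" using False by blast
        then show "u x \<le> 0" using lo[of q x] that[of q] by simp
        show "0 \<le> u x" by (rule ge) (metis that order_refl)
      qed
      have sub: "u (x \<oplus> y) \<le> u x + u y" if xy: "x \<in> carrier V" "y \<in> carrier V" for x y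
      proof -
        \<comment> \<open>An infimum of sublinear functionals need not be subadditive. In a chain it
          is, because the smaller of \<open>q\<close> and \<open>r\<close> can be used at both
          arguments.\<close>
        have 1: "u (x \<oplus> y) - q x \<le> r y" if q: "q \<in> C" and r: "r \<in> C" for q r
        proof (cases "\<forall>x. q x \<le> r x")
          case True
          have "u (x \<oplus> y) \<le> q x + q y" using lo[OF q, of "x \<oplus> y"] sublinear_add[of q x y] xy CS q by fastforce
          then show ?thesis using True[THEN spec, of y] by linarith
        next
          case False
          then have "q x \<ge> r x" using tot[OF q r] by blast
          moreover have "u (x \<oplus> y) \<le> r x + r y" using lo[OF r, of "x \<oplus> y"] sublinear_add[of r x y] xy CS r by fastforce
          ultimately show ?thesis by linarith
        qed
        have 2: "u (x \<oplus> y) - u y \<le> q x" if q: "q \<in> C" for q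
          using ge[of "u (x \<oplus> y) - q x" y] 1[OF q] by fastforce
        show ?thesis using ge[of "u (x \<oplus> y) - u y" x] 2 by fastforce
      qed
      have hom: "u (a \<odot> x) = a * u x" if x: "x \<in> carrier V" and a: "0 \<le> a" for a x
      proof (cases "a = 0")
        case True
        have "u \<zero> = 0" by (rule const) (use CS sublinear_zero in blast)
        then show ?thesis using True x by simp
      next
        case False
        then have a: "a > 0" using a by simp
        have s: "q (a \<odot> x) = a * q x" if "q \<in> C" for q
          using CS that sublinear_scale[of q x a] x a by auto
        have "a * u x \<le> u (a \<odot> x)"
        proof (rule ge)
          fix q assume q: "q \<in> C"
          show "a * u x \<le> q (a \<odot> x)" using lo[OF q, of x] s[OF q] a by simp
        qed
        moreover have "u (a \<odot> x) / a \<le> u x"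
        proof (rule ge)
          fix q assume q: "q \<in> C"
          show "u (a \<odot> x) / a \<le> q x" using lo[OF q, of "a \<odot> x"] s[OF q] a by (simp add: field_simps)
        qed
        ultimately show ?thesis using a by (simp add: field_simps)
      qed
      have "u \<in> ?S"
      proof -
        obtain q where q: "q \<in> C" using False by blast
        have "u x \<le> p x" if "x \<in> carrier V" for x
          using lo[OF q, of x] CS q that by fastforce
        moreover have "u x = 0" if "x \<notin> carrier V" for x
          by (rule const) (use CS that in blast)
        ultimately show ?thesis using sub hom by (auto simp: sublinear_def)
      qed
      then show ?thesis using lo by blast
    qed
  qed
  then obtain m where m: "m \<in> ?S" "\<And>a. a \<in> ?S \<Longrightarrow> ?P m a \<Longrightarrow> a = m" by blast
  have "linear_fun V m"
  proof (rule minimal_sublinear_linear)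
    show "sublinear V m" using m by simp
    fix r assume r: "sublinear V r" "\<forall>x\<in>carrier V. r x \<le> m x"
    let ?r = "\<lambda>x. if x \<in> carrier V then r x else 0"
    have "\<forall>x\<in>carrier V. r x \<le> p x" using r m(1) by (auto intro: order_trans)
    then have "?r = m" by (intro m(2) norm0 r) (use r m(1) in auto)
    then show "\<forall>x\<in>carrier V. r x = m x" by (auto dest: fun_cong)
  qed
  then show ?thesis using m(1) by blast
qed

text \<open>A form of the Mazur-Orlicz theorem. A linear \<open>f\<close> below
  \<open>lowered p W\<close> lies below \<open>p\<close> because of the pair \<open>(0, 0)\<close>,
  and it satisfies the constraint \<open>(w, r)\<close> because the lowered functional is at most
  p(0) - r at -w.\<close>

theorem Hahn_Banach_wedge:
  assumes p: "sublinear V p" and W: "wedge W" and le: "\<And>w r. (w, r) \<in> W \<Longrightarrow> r \<le> p w"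
  shows "\<exists>f. linear_fun V f \<and> (\<forall>x\<in>carrier V. f x \<le> p x) \<and> (\<forall>(w, r)\<in>W. r \<le> f w)"
proof -
  obtain f where f: "linear_fun V f" "\<And>x. x \<in> carrier V \<Longrightarrow> f x \<le> lowered p W x"
    using ex_linear_below[OF lowered_sublinear[OF p W le]] by blast
  have 00: "(\<zero>, 0) \<in> W" using W by (simp add: wedge_def)
  have "f x \<le> p x" if "x \<in> carrier V" for x
    using lowered_le[OF p W le that 00] f(2)[OF that] that by simp
  moreover have "r \<le> f w" if w: "(w, r) \<in> W" for w r
  proof -
    have wc: "w \<in> carrier V" using W w by (auto simp: wedge_def)
    have "lowered p W (\<ominus> w) \<le> - r"
      using lowered_le[OF p W le _ w, of "\<ominus> w"] wc by (simp add: M.l_neg sublinear_zero[OF p])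
    then show ?thesis using f(2)[of "\<ominus> w"] linear_fun_minus[OF f(1) wc] wc by simp
  qed
  ultimately show ?thesis using f(1) by blast
qed

end

section \<open>Positive parts and positive functionals\<close>

context vector_lattice
begin

lemma order_of_simps [simp]:
  "carrier (order_of V) = carrier V" "eq (order_of V) = (=)" "le (order_of V) = leq V"
  by (simp_all add: order_of_def)

lemma leq_refl [simp]: "x \<in> carrier V \<Longrightarrow> x \<preceq> x"
  using ord.le_refl by simp

lemma leq_antisym: "x \<preceq> y \<Longrightarrow> y \<preceq> x \<Longrightarrow> x \<in> carrier V \<Longrightarrow> y \<in> carrier V \<Longrightarrow> x = y"
  using ord.weak_le_antisym by simp

lemma leq_trans:
  "x \<preceq> y \<Longrightarrow> y \<preceq> z \<Longrightarrow> x \<in> carrier V \<Longrightarrow> y \<in> carrier V \<Longrightarrow> z \<in> carrier V \<Longrightarrow> x \<preceq> z"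
  using ord.le_trans by simp

lemma leq_add_cancel:
  assumes "x \<in> carrier V" "y \<in> carrier V" "z \<in> carrier V"
  shows "x \<oplus> z \<preceq> y \<oplus> z \<longleftrightarrow> x \<preceq> y"
proof
  assume "x \<oplus> z \<preceq> y \<oplus> z"
  then have "(x \<oplus> z) \<oplus> \<ominus> z \<preceq> (y \<oplus> z) \<oplus> \<ominus> z"
    using assms leq_add[of "x \<oplus> z" "y \<oplus> z" "\<ominus> z"] by simp
  then show "x \<preceq> y" using assms by (simp add: M.a_assoc M.r_neg)
qed (use assms leq_add in auto)

lemma diff_add: "x \<in> carrier V \<Longrightarrow> y \<in> carrier V \<Longrightarrow> x \<ominus> y \<oplus> y = x"
  by (simp add: a_minus_def M.a_assoc M.l_neg)

lemma diff_leq: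
  "x \<in> carrier V \<Longrightarrow> y \<in> carrier V \<Longrightarrow> z \<in> carrier V \<Longrightarrow> x \<ominus> y \<preceq> z \<longleftrightarrow> x \<preceq> z \<oplus> y"
  using leq_add_cancel[of "x \<ominus> y" z y] by (simp add: diff_add)

lemma leq_diff:
  "x \<in> carrier V \<Longrightarrow> y \<in> carrier V \<Longrightarrow> z \<in> carrier V \<Longrightarrow> z \<preceq> x \<ominus> y \<longleftrightarrow> z \<oplus> y \<preceq> x"
  using leq_add_cancel[of z "x \<ominus> y" y] by (simp add: diff_add)

lemma add_leq_mono:
  assumes "x \<preceq> x'" "y \<preceq> y'"
    "x \<in> carrier V" "x' \<in> carrier V" "y \<in> carrier V" "y' \<in> carrier V"
  shows "x \<oplus> y \<preceq> x' \<oplus> y'"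
proof (rule leq_trans)
  show "x \<oplus> y \<preceq> x' \<oplus> y" using assms leq_add by blast
  show "x' \<oplus> y \<preceq> x' \<oplus> y'" using assms leq_add[of y y' x'] by (simp add: M.a_comm)
qed (use assms in auto)

lemma join_in_carrier [simp]:
  "x \<in> carrier V \<Longrightarrow> y \<in> carrier V \<Longrightarrow> x \<squnion>\<^bsub>order_of V\<^esub> y \<in> carrier V"
  using ord.join_closed by simp

lemma meet_in_carrier [simp]:
  "x \<in> carrier V \<Longrightarrow> y \<in> carrier V \<Longrightarrow> x \<sqinter>\<^bsub>order_of V\<^esub> y \<in> carrier V"
  using ord.meet_closed by simp

lemma join_upper:
  assumes "x \<in> carrier V" "y \<in> carrier V"
  shows "x \<preceq> x \<squnion>\<^bsub>order_of V\<^esub> y" "y \<preceq> x \<squnion>\<^bsub>order_of V\<^esub> y"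
  using ord.join_left ord.join_right assms by auto

lemma join_least:
  assumes "x \<preceq> u" "y \<preceq> u" "x \<in> carrier V" "y \<in> carrier V" "u \<in> carrier V"
  shows "x \<squnion>\<^bsub>order_of V\<^esub> y \<preceq> u"
  using ord.join_le assms by simp

lemma join_eqI:
  assumes "x \<preceq> j" "y \<preceq> j" "\<And>u. u \<in> carrier V \<Longrightarrow> x \<preceq> u \<Longrightarrow> y \<preceq> u \<Longrightarrow> j \<preceq> u"
    "x \<in> carrier V" "y \<in> carrier V" "j \<in> carrier V"
  shows "x \<squnion>\<^bsub>order_of V\<^esub> y = j"
  using assms by (intro leq_antisym join_least) (auto simp: join_upper)

lemma meet_eqI:
  assumes "m \<preceq> x" "m \<preceq> y" "\<And>u. u \<in> carrier V \<Longrightarrow> u \<preceq> x \<Longrightarrow> u \<preceq> y \<Longrightarrow> u \<preceq> m"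
    "x \<in> carrier V" "y \<in> carrier V" "m \<in> carrier V"
  shows "x \<sqinter>\<^bsub>order_of V\<^esub> y = m"
proof (rule leq_antisym)
  show "x \<sqinter>\<^bsub>order_of V\<^esub> y \<preceq> m"
    using ord.meet_left ord.meet_right assms by (intro assms(3)) auto
  show "m \<preceq> x \<sqinter>\<^bsub>order_of V\<^esub> y" using ord.meet_le assms by simp
qed (use assms in auto)

lemma pos_part_closed [simp, intro]: "x \<in> carrier V \<Longrightarrow> pos_part V x \<in> carrier V"
  by (simp add: pos_part_def)

lemma pos_part_upper:
  assumes "x \<in> carrier V"
  shows "x \<preceq> pos_part V x" "\<zero> \<preceq> pos_part V x"
  using assms by (simp_all add: pos_part_def join_upper)

lemma pos_part_least:
  "x \<preceq> u \<Longrightarrow> \<zero> \<preceq> u \<Longrightarrow> x \<in> carrier V \<Longrightarrow> u \<in> carrier V \<Longrightarrow> pos_part V x \<preceq> u"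
  unfolding pos_part_def by (intro join_least) auto

lemma pos_part_of_nonneg: "\<zero> \<preceq> x \<Longrightarrow> x \<in> carrier V \<Longrightarrow> pos_part V x = x"
  unfolding pos_part_def by (intro join_eqI) auto

text \<open>Translation invariance of the order reduces a join to one with zero. With the analogue
  for meets, a linear map is a lattice homomorphism as soon as it respects positive parts, which is
  all that is checked later.\<close>

lemma join_eq_pos_part:
  assumes xy: "x \<in> carrier V" "y \<in> carrier V"
  shows "x \<squnion>\<^bsub>order_of V\<^esub> y = x \<oplus> pos_part V (y \<ominus> x)"
proof (rule join_eqI)
  show "x \<preceq> x \<oplus> pos_part V (y \<ominus> x)"
    using add_leq_mono[of x x \<zero> "pos_part V (y \<ominus> x)"] xy by (simp add: pos_part_upper)
  show "y \<preceq> x \<oplus> pos_part V (y \<ominus> x)"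
    using pos_part_upper(1)[of "y \<ominus> x"] xy by (simp add: diff_leq M.a_comm)
  fix u assume u: "u \<in> carrier V" "x \<preceq> u" "y \<preceq> u"
  then have "pos_part V (y \<ominus> x) \<preceq> u \<ominus> x"
    using xy by (intro pos_part_least) (auto simp: leq_diff diff_add)
  then show "x \<oplus> pos_part V (y \<ominus> x) \<preceq> u"
    using xy u by (simp add: leq_diff M.a_comm)
qed (use xy in auto)

lemma meet_eq_pos_part:
  assumes xy: "x \<in> carrier V" "y \<in> carrier V"
  shows "x \<sqinter>\<^bsub>order_of V\<^esub> y = x \<ominus> pos_part V (x \<ominus> y)"
proof (rule meet_eqI)
  show "x \<ominus> pos_part V (x \<ominus> y) \<preceq> x"
    using add_leq_mono[of x x \<zero> "pos_part V (x \<ominus> y)"] xy by (simp add: pos_part_upper diff_leq)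
  show "x \<ominus> pos_part V (x \<ominus> y) \<preceq> y"
    using pos_part_upper(1)[of "x \<ominus> y"] xy by (simp add: diff_leq M.a_comm)
  fix u assume u: "u \<in> carrier V" "u \<preceq> x" "u \<preceq> y"
  have "\<ominus> y \<oplus> (u \<oplus> x) \<preceq> \<ominus> y \<oplus> (y \<oplus> x)"
    using u xy by (intro add_leq_mono leq_refl) auto
  then have "x \<ominus> y \<oplus> u \<preceq> x"
    using u xy by (simp add: a_minus_def M.a_ac M.r_neg)
  then have "pos_part V (x \<ominus> y) \<preceq> x \<ominus> u"
    using xy u by (intro pos_part_least) (auto simp: leq_diff)
  then show "u \<preceq> x \<ominus> pos_part V (x \<ominus> y)"
    using xy u by (simp add: leq_diff M.a_comm)
qed (use xy in auto)

lemma pos_part_add: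
  "x \<in> carrier V \<Longrightarrow> y \<in> carrier V \<Longrightarrow> pos_part V (x \<oplus> y) \<preceq> pos_part V x \<oplus> pos_part V y"
  using add_leq_mono[of \<zero> "pos_part V x" \<zero> "pos_part V y"]
  by (intro pos_part_least add_leq_mono) (auto simp: pos_part_upper)

lemma pos_part_scale:
  assumes a: "0 \<le> a" and x: "x \<in> carrier V"
  shows "pos_part V (a \<odot> x) = a \<odot> pos_part V x"
proof (cases "a = 0")
  case True
  then show ?thesis using x by (simp add: pos_part_of_nonneg)
next
  case False
  then have a: "a > 0" using a by simp
  have le: "pos_part V (b \<odot> y) \<preceq> b \<odot> pos_part V y" if "b > 0" "y \<in> carrier V" for b y
    using leq_smult[of y "pos_part V y" b] leq_smult[of \<zero> "pos_part V y" b] that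
    by (intro pos_part_least) (auto simp: pos_part_upper)
  have "pos_part V (inverse a \<odot> (a \<odot> x)) \<preceq> inverse a \<odot> pos_part V (a \<odot> x)"
    by (rule le) (use a x in auto)
  then have "pos_part V x \<preceq> inverse a \<odot> pos_part V (a \<odot> x)" using a x by simp
  then have "a \<odot> pos_part V x \<preceq> a \<odot> (inverse a \<odot> pos_part V (a \<odot> x))"
    using a x by (intro leq_smult) auto
  then have "a \<odot> pos_part V x \<preceq> pos_part V (a \<odot> x)" using a x by simp
  then show ?thesis using le[OF a x] a x by (intro leq_antisym) auto
qed

lemma pos_part_minus:
  "x \<in> carrier V \<Longrightarrow> pos_part V x = x \<oplus> pos_part V (\<ominus> x)"
  using join_eq_pos_part[of x \<zero>] by (simp add: a_minus_def pos_part_def)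

lemma modulus_eq:
  assumes x: "x \<in> carrier V"
  shows "modulus V x = pos_part V x \<oplus> pos_part V (\<ominus> x)"
proof -
  have "\<ominus> x \<ominus> x = 2 \<odot> (\<ominus> x)"
    using add_scale[of "\<ominus> x" 1 1] x by (simp add: a_minus_def)
  then have "pos_part V (\<ominus> x \<ominus> x) = 2 \<odot> pos_part V (\<ominus> x)"
    using x by (simp add: pos_part_scale)
  also have "\<dots> = pos_part V (\<ominus> x) \<oplus> pos_part V (\<ominus> x)"
    using add_scale[of "pos_part V (\<ominus> x)" 1 1] x by simp
  finally show ?thesis
    using x join_eq_pos_part[of x "\<ominus> x"] pos_part_minus[OF x]
    by (simp add: modulus_def M.a_assoc)
qed

lemma modulus_closed [simp, intro]: "x \<in> carrier V \<Longrightarrow> modulus V x \<in> carrier V"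
  by (simp add: modulus_def)

lemma modulus_nonneg: "x \<in> carrier V \<Longrightarrow> \<zero> \<preceq> modulus V x"
  using add_leq_mono[of \<zero> "pos_part V x" \<zero> "pos_part V (\<ominus> x)"]
  by (simp add: modulus_eq pos_part_upper)

lemma pos_part_leq_modulus: "x \<in> carrier V \<Longrightarrow> pos_part V x \<preceq> modulus V x"
  using add_leq_mono[of "pos_part V x" "pos_part V x" \<zero> "pos_part V (\<ominus> x)"]
  by (simp add: modulus_eq pos_part_upper)

lemma pos_part_uminus_of_nonneg:
  assumes "\<zero> \<preceq> x" "x \<in> carrier V"
  shows "pos_part V (\<ominus> x) = \<zero>"
  using pos_part_minus[of "\<ominus> x"] assms by (simp add: pos_part_of_nonneg M.l_neg)

lemma modulus_of_nonneg: "\<zero> \<preceq> x \<Longrightarrow> x \<in> carrier V \<Longrightarrow> modulus V x = x"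
  by (simp add: modulus_eq pos_part_of_nonneg pos_part_uminus_of_nonneg)

lemma pos_fun_linear: "pos_fun V f \<Longrightarrow> linear_fun V f"
  by (simp add: pos_fun_def)

lemma pos_fun_mono:
  assumes f: "pos_fun V f" and "x \<preceq> y" "x \<in> carrier V" "y \<in> carrier V"
  shows "f x \<le> f y"
proof -
  have "\<zero> \<preceq> y \<ominus> x" using assms by (simp add: leq_diff)
  then have "0 \<le> f (y \<ominus> x)" using assms by (simp add: pos_fun_def)
  then show ?thesis using linear_fun_diff[OF pos_fun_linear[OF f]] assms by simp
qed

lemma pos_fun_pos_part:
  assumes "pos_fun V f" "x \<in> carrier V"
  shows "f x \<le> f (pos_part V x)" "0 \<le> f (pos_part V x)"
  using assms pos_fun_mono[of f x "pos_part V x"] pos_part_upper[of x] by (auto simp: pos_fun_def)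

lemma pos_fun_modulus:
  assumes f: "pos_fun V f" and x: "x \<in> carrier V"
  shows "f (modulus V x) = 2 * f (pos_part V x) - f x"
  using linear_fun_add[OF pos_fun_linear[OF f], of x "pos_part V (\<ominus> x)"]
    linear_fun_add[OF pos_fun_linear[OF f], of "pos_part V x" "pos_part V (\<ominus> x)"] x
  by (simp add: modulus_eq flip: pos_part_minus)

lemma sublinear_pos_fun:
  assumes f: "pos_fun V f"
  shows "sublinear V (\<lambda>x. f (pos_part V x))"
proof -
  have "f (pos_part V (x \<oplus> y)) \<le> f (pos_part V x) + f (pos_part V y)"
    if "x \<in> carrier V" "y \<in> carrier V" for x y
    using pos_fun_mono[OF f pos_part_add[OF that]] that
    by (simp add: linear_fun_add[OF pos_fun_linear[OF f]])
  then show ?thesis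
    by (simp add: sublinear_def pos_part_scale linear_fun_scale[OF pos_fun_linear[OF f]])
qed

text \<open>A linear \<open>g\<close> below \<open>\<lambda>x. f (pos_part V x)\<close>
  automatically satisfies 0 \<le> g \<le> f on the positive cone: at a positive x the bound reads
  g(x) \<le> f(x), and at -x it reads -g(x) \<le> 0.\<close>

lemma ex_component_functional:
  assumes f: "pos_fun V f" and W: "wedge W" and le: "\<And>w r. (w, r) \<in> W \<Longrightarrow> r \<le> f (pos_part V w)"
  shows "\<exists>g. pos_fun V g \<and> pos_fun V (\<lambda>x. f x - g x) \<and> (\<forall>(w, r)\<in>W. r \<le> g w)"
proof -
  obtain g where g: "linear_fun V g" "\<And>x. x \<in> carrier V \<Longrightarrow> g x \<le> f (pos_part V x)"
    "\<forall>(w, r)\<in>W. r \<le> g w"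
    using Hahn_Banach_wedge[OF sublinear_pos_fun[OF f] W le] by blast
  have "0 \<le> g x" if "x \<in> carrier V" "\<zero> \<preceq> x" for x
    using g(2)[of "\<ominus> x"] that linear_fun_zero[OF pos_fun_linear[OF f]]
    by (simp add: linear_fun_minus[OF g(1)] pos_part_uminus_of_nonneg)
  moreover have "g x \<le> f x" if "x \<in> carrier V" "\<zero> \<preceq> x" for x
    using g(2)[of x] that by (simp add: pos_part_of_nonneg)
  moreover have "linear_fun V (\<lambda>x. f x - g x)"
    using g(1) pos_fun_linear[OF f] by (simp add: linear_fun_def algebra_simps)
  ultimately show ?thesis using g by (auto simp: pos_fun_def)
qed

end

section \<open>Positive functionals bounded by the norm\<close>

context normed_vector_lattice
begin

lemma nrm_mono_nonneg:
  "\<zero> \<preceq> x \<Longrightarrow> x \<preceq> y \<Longrightarrow> x \<in> carrier V \<Longrightarrow> y \<in> carrier V \<Longrightarrow> nrm V x \<le> nrm V y"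
  using leq_trans[of \<zero> x y] by (intro nrm_mono) (auto simp: modulus_of_nonneg)

lemma nrm_modulus: "x \<in> carrier V \<Longrightarrow> nrm V (modulus V x) = nrm V x"
  by (intro antisym nrm_mono) (auto simp: modulus_of_nonneg modulus_nonneg)

lemma nrm_pos_part: "x \<in> carrier V \<Longrightarrow> nrm V (pos_part V x) \<le> nrm V x"
  using nrm_mono_nonneg[of "pos_part V x" "modulus V x"]
  by (simp add: nrm_modulus pos_part_upper pos_part_leq_modulus)

lemma sublinear_nrm: "sublinear V (\<lambda>x. nrm V (pos_part V x))"
proof -
  have "nrm V (pos_part V (x \<oplus> y)) \<le> nrm V (pos_part V x) + nrm V (pos_part V y)"
    if "x \<in> carrier V" "y \<in> carrier V" for x y
  proof -
    have "nrm V (pos_part V (x \<oplus> y)) \<le> nrm V (pos_part V x \<oplus> pos_part V y)"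
      using that by (intro nrm_mono_nonneg) (auto simp: pos_part_upper pos_part_add)
    also have "\<dots> \<le> nrm V (pos_part V x) + nrm V (pos_part V y)"
      using that by (intro nrm_triangle) auto
    finally show ?thesis .
  qed
  then show ?thesis by (simp add: sublinear_def pos_part_scale nrm_smult)
qed

text \<open>Domination by the norm of the positive part gives positivity and the norm bound
  together: the dominating functional vanishes at -x for positive x, and it never exceeds the
  norm.\<close>

lemma ex_bounded_functional:
  assumes W: "wedge W" and le: "\<And>w r. (w, r) \<in> W \<Longrightarrow> r \<le> nrm V (pos_part V w)"
  shows "\<exists>g. pos_fun V g \<and> (\<forall>x\<in>carrier V. g x \<le> nrm V x) \<and> (\<forall>(w, r)\<in>W. r \<le> g w)"
proof -
  obtain g where g: "linear_fun V g" "\<And>x. x \<in> carrier V \<Longrightarrow> g x \<le> nrm V (pos_part V x)"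
    "\<forall>(w, r)\<in>W. r \<le> g w"
    using Hahn_Banach_wedge[OF sublinear_nrm W le] by blast
  have "0 \<le> g x" if "x \<in> carrier V" "\<zero> \<preceq> x" for x
    using g(2)[of "\<ominus> x"] that nrm_eq_0[of \<zero>]
    by (simp add: linear_fun_minus[OF g(1)] pos_part_uminus_of_nonneg)
  moreover have "g x \<le> nrm V x" if "x \<in> carrier V" for x
    using g(2)[OF that] nrm_pos_part[OF that] by linarith
  ultimately show ?thesis using g by (auto simp: pos_fun_def)
qed

text \<open>The constraint along the ray through |x| is consistent because |x| is its own positive
  part and has the same norm as x.\<close>

lemma ex_norming_functional:
  assumes x: "x \<in> carrier V"
  shows "\<exists>g. pos_fun V g \<and> (\<forall>y\<in>carrier V. g y \<le> nrm V y) \<and> g (modulus V x) = nrm V x"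
proof -
  have le: "r \<le> nrm V (pos_part V w)" if "(w, r) \<in> ray (modulus V x) (nrm V x)" for w r
    using that x by (auto simp: ray_def pos_part_scale pos_part_of_nonneg modulus_nonneg nrm_smult nrm_modulus)
  obtain g where g: "pos_fun V g" "\<forall>y\<in>carrier V. g y \<le> nrm V y"
    "\<forall>(w, r)\<in>ray (modulus V x) (nrm V x). r \<le> g w"
    using ex_bounded_functional[OF wedge_ray le] x by blast
  have "nrm V x \<le> g (modulus V x)"
    using g(3) self_in_ray[of "modulus V x" "nrm V x"] x by blast
  then have "g (modulus V x) = nrm V x"
    using g(2) x by (intro antisym) (auto simp: nrm_modulus dest: bspec[of _ _ "modulus V x"])
  then show ?thesis using g by blast
qed

end

lemma (in vector_lattice) pos_fun_abs_le:
  assumes f: "pos_fun V f" and x: "x \<in> carrier V"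
  shows "\<bar>f x\<bar> \<le> f (modulus V x)"
  using pos_fun_modulus[OF f x] pos_fun_pos_part[OF f x] by (auto simp: abs_if)

text \<open>Sublinearity of \<open>\<lambda>x. f (pos_part V x)\<close>, used in both directions.
  The bound by the value at |x - y| allows summation over a level of the tree, and so carries
  statements about positive parts from dense vectors to all vectors.\<close>

lemma (in vector_lattice) pos_fun_pos_part_diff:
  assumes f: "pos_fun V f" and x: "x \<in> carrier V" and y: "y \<in> carrier V"
  shows "\<bar>f (pos_part V x) - f (pos_part V y)\<bar> \<le> f (modulus V (x \<ominus> y))"
proof -
  note lin = pos_fun_linear[OF f]
  have le: "f (pos_part V a) \<le> f (pos_part V b) + f (pos_part V (a \<ominus> b))"
    if "a \<in> carrier V" "b \<in> carrier V" for a b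
    using sublinear_add[OF sublinear_pos_fun[OF f], of "a \<ominus> b" b] that by (simp add: diff_add)
  have "y \<ominus> x = \<ominus> (x \<ominus> y)" using x y by (simp add: a_minus_def M.minus_add M.a_comm)
  moreover have "f (modulus V (x \<ominus> y)) = f (pos_part V (x \<ominus> y)) + f (pos_part V (\<ominus> (x \<ominus> y)))"
    using x y by (simp add: modulus_eq linear_fun_add[OF lin])
  moreover have "0 \<le> f (pos_part V (x \<ominus> y))" "0 \<le> f (pos_part V (\<ominus> (x \<ominus> y)))"
    using x y by (auto intro!: pos_fun_pos_part(2)[OF f])
  ultimately show ?thesis using le[OF x y] le[OF y x] by simp
qed

lemma (in normed_vector_lattice) nrm_diff_commute:
  assumes "x \<in> carrier V" "y \<in> carrier V"
  shows "nrm V (x \<ominus> y) = nrm V (y \<ominus> x)"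
  using Metric_space.commute[OF Metric_space_nrm_dist, of x y] assms by (simp add: nrm_dist_def)

lemma (in separable_banach_lattice) ex_countable_dense:
  "\<exists>D\<subseteq>carrier V. countable D \<and> (\<forall>x\<in>carrier V. \<forall>e>0. \<exists>d\<in>D. nrm V (x \<ominus> d) < e)"
proof -
  interpret M: Metric_space "carrier V" "nrm_dist V" by (rule Metric_space_nrm_dist)
  obtain D where D: "countable D" "D \<subseteq> carrier V" "M.mtopology closure_of D = carrier V"
    using separable by (auto simp: separable_space_def)
  have "\<exists>d\<in>D. nrm V (x \<ominus> d) < e" if "x \<in> carrier V" "e > 0" for x e
  proof -
    have "x \<in> M.mtopology closure_of D" using D(3) that(1) by simp
    with \<open>e > 0\<close> obtain d where "d \<in> D" "d \<in> M.mball x e"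
      unfolding M.metric_closure_of by blast
    then show ?thesis using that(1) by (auto simp: nrm_dist_def)
  qed
  then show ?thesis using D by blast
qed

lemma lattice_embedding_comp:
  assumes f: "lattice_embedding A B f" and g: "lattice_embedding B C g"
  shows "lattice_embedding A C (g \<circ> f)"
proof -
  have "f x \<in> carrier B" if "x \<in> carrier A" for x using f that by (auto simp: lattice_embedding_def)
  then show ?thesis using f g by (auto simp: lattice_embedding_def)
qed

section \<open>Restriction and extension of functionals along an embedding\<close>

locale embedded = dom: normed_vector_lattice E + cod: normed_vector_lattice A
  for E :: "'e normed_lattice" and A :: "'a normed_lattice" and f +
  assumes emb: "lattice_embedding E A f"
begin

lemma emb_closed [simp, intro]: "x \<in> carrier E \<Longrightarrow> f x \<in> carrier A"
  using emb by (auto simp: lattice_embedding_def)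

lemma emb_add: "x \<in> carrier E \<Longrightarrow> y \<in> carrier E \<Longrightarrow> f (x \<oplus>\<^bsub>E\<^esub> y) = f x \<oplus>\<^bsub>A\<^esub> f y"
  using emb by (simp add: lattice_embedding_def)

lemma emb_scale: "x \<in> carrier E \<Longrightarrow> f (a \<odot>\<^bsub>E\<^esub> x) = a \<odot>\<^bsub>A\<^esub> f x"
  using emb by (simp add: lattice_embedding_def)

lemma emb_zero: "f \<zero>\<^bsub>E\<^esub> = \<zero>\<^bsub>A\<^esub>"
  using emb_scale[of "\<zero>\<^bsub>E\<^esub>" 0] by simp

lemma emb_nrm: "x \<in> carrier E \<Longrightarrow> nrm A (f x) = nrm E x"
  using emb by (simp add: lattice_embedding_def)

lemma emb_pos_part: "x \<in> carrier E \<Longrightarrow> f (pos_part E x) = pos_part A (f x)"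
  using emb by (simp add: pos_part_def lattice_embedding_def emb_zero)

lemma emb_pos:
  assumes "x \<in> carrier E" "leq E \<zero>\<^bsub>E\<^esub> x"
  shows "leq A \<zero>\<^bsub>A\<^esub> (f x)"
  using cod.pos_part_upper(2)[of "f x"] assms emb_pos_part[of x]
  by (simp add: dom.pos_part_of_nonneg)

lemma pos_fun_restrict: "pos_fun A g \<Longrightarrow> pos_fun E (\<lambda>x. g (f x))"
  by (simp add: pos_fun_def linear_fun_def emb_add emb_scale emb_pos)

lemma wedge_graph:
  assumes "linear_fun E h"
  shows "cod.wedge ((\<lambda>e. (f e, h e)) ` carrier E)"
  unfolding cod.wedge_def
proof (intro conjI allI impI)
  show "(\<zero>\<^bsub>A\<^esub>, 0) \<in> (\<lambda>e. (f e, h e)) ` carrier E"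
    by (rule image_eqI[of _ _ "\<zero>\<^bsub>E\<^esub>"]) (auto simp: emb_zero dom.linear_fun_zero[OF assms])
  fix x r y s assume "(x, r) \<in> (\<lambda>e. (f e, h e)) ` carrier E" "(y, s) \<in> (\<lambda>e. (f e, h e)) ` carrier E"
  then obtain d e where "d \<in> carrier E" "e \<in> carrier E" "x = f d" "y = f e" "r = h d" "s = h e"
    by auto
  then show "(x \<oplus>\<^bsub>A\<^esub> y, r + s) \<in> (\<lambda>e. (f e, h e)) ` carrier E"
    by (intro image_eqI[of _ _ "d \<oplus>\<^bsub>E\<^esub> e"]) (auto simp: emb_add dom.linear_fun_add[OF assms])
next
  fix a :: real and x r assume "(x, r) \<in> (\<lambda>e. (f e, h e)) ` carrier E"
  then obtain e where "e \<in> carrier E" "x = f e" "r = h e"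
    by auto
  then show "(a \<odot>\<^bsub>A\<^esub> x, a * r) \<in> (\<lambda>e. (f e, h e)) ` carrier E"
    by (intro image_eqI[of _ _ "a \<odot>\<^bsub>E\<^esub> e"]) (auto simp: emb_scale dom.linear_fun_scale[OF assms])
qed auto

text \<open>The graph is a subspace, so the lower bounds at e and at -e together force equality.
  This turns the inequality constraints of a wedge into an extension theorem.\<close>

lemma graph_bound_eq:
  assumes h: "linear_fun E h" and g: "linear_fun A g"
    and le: "\<forall>(w, r)\<in>(\<lambda>e. (f e, h e)) ` carrier E. r \<le> g w" and e: "e \<in> carrier E"
  shows "g (f e) = h e"
proof -
  have le: "h d \<le> g (f d)" if "d \<in> carrier E" for d using le that by auto
  have "f (\<ominus>\<^bsub>E\<^esub> e) = \<ominus>\<^bsub>A\<^esub> f e"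
    using e by (simp add: dom.minus_eq_scale cod.minus_eq_scale emb_scale)
  then show ?thesis
    using le[OF e] le[of "\<ominus>\<^bsub>E\<^esub> e"] e
    by (simp add: dom.linear_fun_minus[OF h] cod.linear_fun_minus[OF g])
qed

text \<open>The graph of \<open>h\<close> is consistent with domination by \<open>g\<close> at
  positive parts because h(e) \<le> h(e^+) \<le> g(f(e^+)) = g(f(e)^+). The last equality is where
  the embedding must respect the lattice structure, not only the order and the norm.\<close>

lemma ex_extension_below:
  assumes g: "pos_fun A g" and h: "pos_fun E h" and gh: "pos_fun E (\<lambda>e. g (f e) - h e)"
  shows "\<exists>k. pos_fun A k \<and> pos_fun A (\<lambda>x. g x - k x) \<and> (\<forall>e\<in>carrier E. k (f e) = h e)"
proof -
  have le: "r \<le> g (pos_part A w)" if "(w, r) \<in> (\<lambda>e. (f e, h e)) ` carrier E" for w r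
  proof -
    from that obtain e where e: "e \<in> carrier E" "w = f e" "r = h e" by blast
    then have "h e \<le> h (pos_part E e)" using dom.pos_fun_pos_part(1)[OF h] by simp
    also have "\<dots> \<le> g (f (pos_part E e))"
      using dom.pos_fun_pos_part(2)[OF gh, of "pos_part E e"] e
      by (simp add: dom.pos_part_of_nonneg dom.pos_part_upper)
    finally show ?thesis using e by (simp add: emb_pos_part)
  qed
  show ?thesis
    using cod.ex_component_functional[OF g wedge_graph[OF dom.pos_fun_linear[OF h]] le]
      graph_bound_eq[OF dom.pos_fun_linear[OF h] cod.pos_fun_linear] by blast
qed

text \<open>The same chain with norms: h(e) \<le> h(e^+) \<le> ||e^+|| = ||f(e)^+||, where the
  equality uses that the embedding is isometric and respects positive parts.\<close>

lemma ex_extension_bounded: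
  assumes h: "pos_fun E h" and le: "\<And>e. e \<in> carrier E \<Longrightarrow> h e \<le> nrm E e"
  shows "\<exists>k. pos_fun A k \<and> (\<forall>x\<in>carrier A. k x \<le> nrm A x) \<and> (\<forall>e\<in>carrier E. k (f e) = h e)"
proof -
  have le': "r \<le> nrm A (pos_part A w)" if "(w, r) \<in> (\<lambda>e. (f e, h e)) ` carrier E" for w r
  proof -
    from that obtain e where e: "e \<in> carrier E" "w = f e" "r = h e" by blast
    then have "h e \<le> h (pos_part E e)" using dom.pos_fun_pos_part(1)[OF h] by simp
    also have "\<dots> \<le> nrm E (pos_part E e)" using le e by simp
    finally show ?thesis using e by (simp flip: emb_pos_part add: emb_nrm)
  qed
  show ?thesis
    using cod.ex_bounded_functional[OF wedge_graph[OF dom.pos_fun_linear[OF h]] le']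
      graph_bound_eq[OF dom.pos_fun_linear[OF h] cod.pos_fun_linear] by blast
qed

end

text \<open>The value p1(a^+) is the largest that a component of \<open>p1\<close> can take at
  \<open>a\<close>, and the ray constraint makes \<open>q1\<close> attain it. On \<open>E\<close>
  the restriction of \<open>q1\<close> lies below that of \<open>p1\<close>, which equals that of
  \<open>p2\<close>; so it extends to a component of \<open>p2\<close>.\<close>

lemma ex_compatible_split:
  assumes "embedded E A1 f1" "embedded E A2 f2"
    and p1: "pos_fun A1 p1" and p2: "pos_fun A2 p2"
    and eq: "\<And>e. e \<in> carrier E \<Longrightarrow> p1 (f1 e) = p2 (f2 e)" and a: "a \<in> carrier A1"
  shows "\<exists>q1 q2. pos_fun A1 q1 \<and> pos_fun A2 q2 \<and> pos_fun A1 (\<lambda>x. p1 x - q1 x) \<and>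
    pos_fun A2 (\<lambda>x. p2 x - q2 x) \<and> (\<forall>e\<in>carrier E. q1 (f1 e) = q2 (f2 e)) \<and> q1 a = p1 (pos_part A1 a)"
proof -
  interpret e1: embedded E A1 f1 by fact
  interpret e2: embedded E A2 f2 by fact
  have lin: "linear_fun A1 p1" using p1 by (simp add: pos_fun_def)
  have le: "r \<le> p1 (pos_part A1 w)" if "(w, r) \<in> e1.cod.ray a (p1 (pos_part A1 a))" for w r
    using that a by (auto simp: e1.cod.ray_def e1.cod.pos_part_scale e1.cod.linear_fun_scale[OF lin])
  obtain q1 where q1: "pos_fun A1 q1" "pos_fun A1 (\<lambda>x. p1 x - q1 x)"
    "\<forall>(w, r)\<in>e1.cod.ray a (p1 (pos_part A1 a)). r \<le> q1 w"
    using e1.cod.ex_component_functional[OF p1 e1.cod.wedge_ray[OF a] le] by blast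
  have "p1 (pos_part A1 a) \<le> q1 a" using q1(3) e1.cod.self_in_ray[OF a] by blast
  moreover have "q1 a \<le> q1 (pos_part A1 a)" using e1.cod.pos_fun_pos_part(1)[OF q1(1) a] .
  moreover have "q1 (pos_part A1 a) \<le> p1 (pos_part A1 a)"
    using e1.cod.pos_fun_pos_part(2)[OF q1(2) a] by simp
  ultimately have q1a: "q1 a = p1 (pos_part A1 a)" by linarith
  have "pos_fun E (\<lambda>e. p1 (f1 e) - q1 (f1 e))" using e1.pos_fun_restrict[OF q1(2)] .
  then have "pos_fun E (\<lambda>e. p2 (f2 e) - q1 (f1 e))"
    using eq by (simp add: pos_fun_def linear_fun_def)
  then obtain q2 where "pos_fun A2 q2" "pos_fun A2 (\<lambda>x. p2 x - q2 x)" "\<forall>e\<in>carrier E. q2 (f2 e) = q1 (f1 e)"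
    using e2.ex_extension_below[OF p2 e1.pos_fun_restrict[OF q1(1)]] by blast
  then show ?thesis using q1 q1a by (intro exI[of _ q1] exI[of _ q2]) simp
qed

text \<open>The partner functional on the other lattice is only known to be bounded by the norm.
  Elements of that lattice are normed by pairs of their own, obtained by exchanging the two
  embeddings.\<close>

lemma ex_compatible_norming:
  assumes "embedded E A1 f1" "embedded E A2 f2" and a: "a \<in> carrier A1"
  shows "\<exists>q1 q2. pos_fun A1 q1 \<and> pos_fun A2 q2 \<and> (\<forall>e\<in>carrier E. q1 (f1 e) = q2 (f2 e)) \<and>
    (\<forall>x\<in>carrier A1. q1 x \<le> nrm A1 x) \<and> (\<forall>x\<in>carrier A2. q2 x \<le> nrm A2 x) \<and>
    q1 (modulus A1 a) = nrm A1 a"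
proof -
  interpret e1: embedded E A1 f1 by fact
  interpret e2: embedded E A2 f2 by fact
  obtain q1 where q1: "pos_fun A1 q1" "\<forall>x\<in>carrier A1. q1 x \<le> nrm A1 x" "q1 (modulus A1 a) = nrm A1 a"
    using e1.cod.ex_norming_functional[OF a] by blast
  have "q1 (f1 e) \<le> nrm E e" if "e \<in> carrier E" for e
    using q1(2) that by (metis e1.emb_closed e1.emb_nrm)
  then show ?thesis
    using e2.ex_extension_bounded[OF e1.pos_fun_restrict[OF q1(1)]] q1 by metis
qed

section \<open>Banach lattices as quotients of seminormed function lattices\<close>

lemma least_UpperI:
  assumes "x \<in> carrier L" "y \<in> carrier L" "s \<in> carrier L" "x \<sqsubseteq>\<^bsub>L\<^esub> s" "y \<sqsubseteq>\<^bsub>L\<^esub> s"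
    and "\<And>u. u \<in> carrier L \<Longrightarrow> x \<sqsubseteq>\<^bsub>L\<^esub> u \<Longrightarrow> y \<sqsubseteq>\<^bsub>L\<^esub> u \<Longrightarrow> s \<sqsubseteq>\<^bsub>L\<^esub> u"
  shows "least L s (Upper L {x, y})"
  using assms by (auto simp: least_def Upper_def)

lemma greatest_LowerI:
  assumes "x \<in> carrier L" "y \<in> carrier L" "s \<in> carrier L" "s \<sqsubseteq>\<^bsub>L\<^esub> x" "s \<sqsubseteq>\<^bsub>L\<^esub> y"
    and "\<And>u. u \<in> carrier L \<Longrightarrow> u \<sqsubseteq>\<^bsub>L\<^esub> x \<Longrightarrow> u \<sqsubseteq>\<^bsub>L\<^esub> y \<Longrightarrow> u \<sqsubseteq>\<^bsub>L\<^esub> s"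
  shows "greatest L s (Lower L {x, y})"
  using assms by (auto simp: greatest_def Lower_def)

text \<open>Since \<open>N\<close> is only a seminorm, limits are determined up to null functions,
  and completeness and density are stated with epsilons. \<open>N_mono\<close> makes
  \<open>N\<close> a lattice seminorm.\<close>

locale seminormed_function_lattice =
  fixes C :: "('k \<Rightarrow> real) set" and N :: "('k \<Rightarrow> real) \<Rightarrow> real"
  assumes zero_mem: "(\<lambda>k. 0) \<in> C"
    and add_mem: "u \<in> C \<Longrightarrow> v \<in> C \<Longrightarrow> (\<lambda>k. u k + v k) \<in> C"
    and scale_mem: "u \<in> C \<Longrightarrow> (\<lambda>k. a * u k) \<in> C"
    and pos_mem: "u \<in> C \<Longrightarrow> (\<lambda>k. max 0 (u k)) \<in> C"
    and N_add: "u \<in> C \<Longrightarrow> v \<in> C \<Longrightarrow> N (\<lambda>k. u k + v k) \<le> N u + N v"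
    and N_scale: "u \<in> C \<Longrightarrow> N (\<lambda>k. a * u k) = \<bar>a\<bar> * N u"
    and N_mono: "u \<in> C \<Longrightarrow> v \<in> C \<Longrightarrow> (\<And>k. \<bar>u k\<bar> \<le> \<bar>v k\<bar>) \<Longrightarrow> N u \<le> N v"
    and N_complete: "(\<And>n::nat. s n \<in> C) \<Longrightarrow>
      (\<And>e. e > 0 \<Longrightarrow> \<exists>m. \<forall>i\<ge>m. \<forall>j\<ge>m. N (\<lambda>k. s i k - s j k) < e) \<Longrightarrow>
      \<exists>u\<in>C. \<forall>e>0. \<exists>m. \<forall>i\<ge>m. N (\<lambda>k. s i k - u k) < e"
    and N_separable: "\<exists>D\<subseteq>C. countable D \<and> (\<forall>u\<in>C. \<forall>e>0. \<exists>d\<in>D. N (\<lambda>k. u k - d k) < e)"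
begin

lemma diff_mem: "u \<in> C \<Longrightarrow> v \<in> C \<Longrightarrow> (\<lambda>k. u k - v k) \<in> C"
  using add_mem[of u "\<lambda>k. -1 * v k"] scale_mem[of v "-1"] by simp

lemma uminus_mem: "u \<in> C \<Longrightarrow> (\<lambda>k. - u k) \<in> C"
  using scale_mem[of u "-1"] by simp

lemma max_mem: "u \<in> C \<Longrightarrow> v \<in> C \<Longrightarrow> (\<lambda>k. max (u k) (v k)) \<in> C"
proof -
  assume uv: "u \<in> C" "v \<in> C"
  have "(\<lambda>k. u k + max 0 (v k - u k)) = (\<lambda>k. max (u k) (v k))" by (auto simp: max_def)
  then show ?thesis using add_mem[OF uv(1) pos_mem[OF diff_mem[OF uv(2,1)]]] by simp
qed

lemma min_mem: "u \<in> C \<Longrightarrow> v \<in> C \<Longrightarrow> (\<lambda>k. min (u k) (v k)) \<in> C"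
proof -
  assume uv: "u \<in> C" "v \<in> C"
  have "(\<lambda>k. u k - max 0 (u k - v k)) = (\<lambda>k. min (u k) (v k))" by (auto simp: max_def min_def)
  then show ?thesis using diff_mem[OF uv(1) pos_mem[OF diff_mem[OF uv]]] by simp
qed

lemma abs_mem: "u \<in> C \<Longrightarrow> (\<lambda>k. \<bar>u k\<bar>) \<in> C"
proof -
  assume u: "u \<in> C"
  have "(\<lambda>k. max (u k) (- u k)) = (\<lambda>k. \<bar>u k\<bar>)" by auto
  then show ?thesis using max_mem[OF u uminus_mem[OF u]] by simp
qed

lemmas mem = zero_mem add_mem scale_mem pos_mem diff_mem uminus_mem max_mem min_mem abs_mem

lemma N_zero: "N (\<lambda>k. 0) = 0"
  using N_scale[OF zero_mem, of 0] by simp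

lemma N_nonneg: "u \<in> C \<Longrightarrow> 0 \<le> N u"
  using N_mono[of "\<lambda>k. 0" u] by (simp add: zero_mem N_zero)

lemma N_abs: "u \<in> C \<Longrightarrow> N (\<lambda>k. \<bar>u k\<bar>) = N u"
  by (intro antisym N_mono) (auto intro: mem)

lemma N_le_add:
  assumes "u \<in> C" "v \<in> C" "w \<in> C" "\<And>k. \<bar>u k\<bar> \<le> \<bar>v k\<bar> + \<bar>w k\<bar>"
  shows "N u \<le> N v + N w"
proof -
  have "N u \<le> N (\<lambda>k. \<bar>v k\<bar> + \<bar>w k\<bar>)" using assms by (intro N_mono) (auto intro: mem)
  also have "\<dots> \<le> N (\<lambda>k. \<bar>v k\<bar>) + N (\<lambda>k. \<bar>w k\<bar>)" using assms by (intro N_add) (auto intro: mem)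
  finally show ?thesis using assms by (simp add: N_abs)
qed

text \<open>Null functions form an ideal of \<open>C\<close>. Well-definedness of the operations, of
  the order and of the choice of representatives all reduce to a pointwise inequality through this
  fact.\<close>

lemma null_le_add:
  assumes "N v = 0" "N w = 0" "\<And>k. \<bar>u k\<bar> \<le> \<bar>v k\<bar> + \<bar>w k\<bar>" "u \<in> C" "v \<in> C" "w \<in> C"
  shows "N u = 0"
  using N_le_add[OF assms(4,5,6,3)] N_nonneg[OF assms(4)] assms(1,2) by simp

text \<open>The condition on \<open>v\<close> is the same predicate for all \<open>u\<close> in
  \<open>C\<close> that differ by a null function, so the choice depends only on the class. The
  quotient then consists of functions, one per class, instead of sets of functions.\<close>

definition rep :: "('k \<Rightarrow> real) \<Rightarrow> 'k \<Rightarrow> real" where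
  "rep u = (SOME v. v \<in> C \<and> N (\<lambda>k. v k - u k) = 0)"

text \<open>The quotient by the ideal of null functions; its order says that x \<le> y up to a null
  function.\<close>

definition quot :: "('k \<Rightarrow> real) normed_lattice" where
  "quot = \<lparr>carrier = rep ` C, mult = (\<lambda>x y. x), one = rep (\<lambda>k. 0), zero = rep (\<lambda>k. 0),
     add = (\<lambda>x y. rep (\<lambda>k. x k + y k)), smult = (\<lambda>a x. rep (\<lambda>k. a * x k)),
     leq = (\<lambda>x y. N (\<lambda>k. max 0 (x k - y k)) = 0), nrm = N\<rparr>"

lemma rep:
  assumes "u \<in> C"
  shows rep_mem: "rep u \<in> C" and N_rep_diff: "N (\<lambda>k. rep u k - u k) = 0"
proof -
  have "u \<in> C \<and> N (\<lambda>k. u k - u k) = 0" using assms by (simp add: N_zero)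
  then have "rep u \<in> C \<and> N (\<lambda>k. rep u k - u k) = 0"
    unfolding rep_def by (rule someI[where P = "\<lambda>v. v \<in> C \<and> N (\<lambda>k. v k - u k) = 0"])
  then show "rep u \<in> C" "N (\<lambda>k. rep u k - u k) = 0" by auto
qed

lemma rep_eqI:
  assumes "u \<in> C" "v \<in> C" "N (\<lambda>k. u k - v k) = 0"
  shows "rep u = rep v"
proof -
  have "N (\<lambda>k. w k - u k) = 0 \<longleftrightarrow> N (\<lambda>k. w k - v k) = 0" if "w \<in> C" for w
  proof
    assume "N (\<lambda>k. w k - u k) = 0"
    then show "N (\<lambda>k. w k - v k) = 0"
      by (rule null_le_add[OF _ assms(3)]) (use assms that in \<open>auto intro!: mem\<close>)
  next
    assume "N (\<lambda>k. w k - v k) = 0"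
    then show "N (\<lambda>k. w k - u k) = 0"
      by (rule null_le_add[OF _ assms(3)]) (use assms that in \<open>auto intro!: mem\<close>)
  qed
  then have "(\<lambda>w. w \<in> C \<and> N (\<lambda>k. w k - u k) = 0) = (\<lambda>w. w \<in> C \<and> N (\<lambda>k. w k - v k) = 0)"
    by auto
  then show ?thesis by (simp add: rep_def)
qed

lemma rep_eq_iff:
  assumes "u \<in> C" "v \<in> C"
  shows "rep u = rep v \<longleftrightarrow> N (\<lambda>k. u k - v k) = 0"
proof
  assume eq: "rep u = rep v"
  show "N (\<lambda>k. u k - v k) = 0"
    by (rule null_le_add[OF N_rep_diff[OF assms(1)] N_rep_diff[OF assms(2)]])
      (use assms eq in \<open>auto intro!: mem rep_mem\<close>)
qed (use rep_eqI assms in blast)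

lemma N_rep: "u \<in> C \<Longrightarrow> N (rep u) = N u"
proof -
  assume u: "u \<in> C"
  have "N (rep u) \<le> N (\<lambda>k. rep u k - u k) + N u"
    by (rule N_le_add) (use u in \<open>auto intro!: mem rep_mem\<close>)
  moreover have "N u \<le> N (\<lambda>k. rep u k - u k) + N (rep u)"
    by (rule N_le_add) (use u in \<open>auto intro!: mem rep_mem\<close>)
  ultimately show ?thesis using N_rep_diff[OF u] by simp
qed

lemma quot_carrier: "x \<in> carrier quot \<longleftrightarrow> (\<exists>u\<in>C. x = rep u)"
  by (auto simp: quot_def)

lemma rep_in_quot: "u \<in> C \<Longrightarrow> rep u \<in> carrier quot"
  by (auto simp: quot_carrier)

lemma ex_rep: "u \<in> C \<Longrightarrow> \<exists>v\<in>C. rep u = rep v"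
  by blast

lemma quot_zero: "\<zero>\<^bsub>quot\<^esub> = rep (\<lambda>k. 0)"
  by (simp add: quot_def)

lemma quot_add: "u \<in> C \<Longrightarrow> v \<in> C \<Longrightarrow> rep u \<oplus>\<^bsub>quot\<^esub> rep v = rep (\<lambda>k. u k + v k)"
  unfolding quot_def ring_record_simps
  by (rule rep_eqI, intro mem rep_mem, assumption, assumption, intro mem, assumption, assumption,
      rule null_le_add[OF N_rep_diff[of u] N_rep_diff[of v]]) (auto intro!: mem rep_mem)

lemma quot_smult: "u \<in> C \<Longrightarrow> a \<odot>\<^bsub>quot\<^esub> rep u = rep (\<lambda>k. a * u k)"
proof -
  assume u: "u \<in> C"
  have "N (\<lambda>k. a * rep u k - a * u k) = N (\<lambda>k. a * (rep u k - u k))"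
    by (simp add: right_diff_distrib)
  also have "\<dots> = 0" using N_scale[of "\<lambda>k. rep u k - u k" a] u N_rep_diff[OF u] by (simp add: mem rep_mem)
  finally have "rep (\<lambda>k. a * rep u k) = rep (\<lambda>k. a * u k)"
    using u by (intro rep_eqI mem rep_mem) auto
  then show ?thesis by (simp add: quot_def)
qed

lemma quot_leq: "u \<in> C \<Longrightarrow> v \<in> C \<Longrightarrow> leq quot (rep u) (rep v) \<longleftrightarrow> N (\<lambda>k. max 0 (u k - v k)) = 0"
proof -
  assume uv: "u \<in> C" "v \<in> C"
  \<comment> \<open>Taking positive parts is 1-Lipschitz, so replacing \<open>u\<close> and
    \<open>v\<close> by their representatives changes the positive part of the difference by at most
    the null function \<open>?w\<close>.\<close>
  let ?w = "\<lambda>k. \<bar>rep u k - u k\<bar> + \<bar>rep v k - v k\<bar>"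
  have w: "N ?w = 0"
    by (rule null_le_add[OF N_rep_diff[OF uv(1)] N_rep_diff[OF uv(2)]])
      (use uv in \<open>auto intro!: mem rep_mem\<close>)
  have "N (\<lambda>k. max 0 (rep u k - rep v k)) = 0 \<longleftrightarrow> N (\<lambda>k. max 0 (u k - v k)) = 0"
  proof
    assume "N (\<lambda>k. max 0 (rep u k - rep v k)) = 0"
    then show "N (\<lambda>k. max 0 (u k - v k)) = 0"
      by (rule null_le_add[OF _ w]) (use uv in \<open>auto intro!: mem rep_mem\<close>)
  next
    assume "N (\<lambda>k. max 0 (u k - v k)) = 0"
    then show "N (\<lambda>k. max 0 (rep u k - rep v k)) = 0"
      by (rule null_le_add[OF _ w]) (use uv in \<open>auto intro!: mem rep_mem\<close>)
  qed
  then show ?thesis by (simp add: quot_def)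
qed

lemma quot_nrm: "u \<in> C \<Longrightarrow> nrm quot (rep u) = N u"
  by (simp add: quot_def N_rep)

lemmas quot_simps = quot_zero quot_add quot_smult quot_leq quot_nrm rep_in_quot

lemma abelian_group_quot: "abelian_group quot"
proof (rule abelian_groupI)
  fix x assume "x \<in> carrier quot"
  then obtain u where "u \<in> C" "x = rep u" by (auto simp: quot_carrier)
  then show "\<exists>y\<in>carrier quot. y \<oplus>\<^bsub>quot\<^esub> x = \<zero>\<^bsub>quot\<^esub>"
    by (intro bexI[of _ "rep (\<lambda>k. - u k)"]) (simp_all add: quot_simps mem)
qed (auto simp: quot_carrier quot_simps mem add_ac intro!: ex_rep mem)

lemma module_quot: "module real_ring quot"
proof (rule moduleI)
  have "comm_monoid real_ring" "abelian_group real_ring"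
    by (auto simp: real_ring_def intro!: comm_monoidI abelian_groupI bexI[of _ "- _"])
  then show "cring real_ring"
    by (intro cringI) (auto simp: real_ring_def algebra_simps)
qed (use abelian_group_quot in \<open>auto simp: real_ring_def quot_carrier quot_simps mem algebra_simps intro!: ex_rep mem\<close>)

lemma lattice_quot: "Lattice.lattice (order_of quot)"
proof
  have leqI: "leq quot (rep u) (rep v)"
    if "N a = 0" "N b = 0" "a \<in> C" "b \<in> C" "u \<in> C" "v \<in> C" "\<And>k. max 0 (u k - v k) \<le> \<bar>a k\<bar> + \<bar>b k\<bar>"
    for a b u v
  proof -
    have "N (\<lambda>k. max 0 (u k - v k)) = 0"
      by (rule null_le_add[OF that(1,2)]) (use that in \<open>auto intro!: mem\<close>)
    then show ?thesis using that by (simp add: quot_leq)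
  qed
  have leqI0: "leq quot (rep u) (rep v)" if "u \<in> C" "v \<in> C" "\<And>k. u k \<le> v k" for u v
    by (rule leqI[OF N_zero N_zero zero_mem zero_mem]) (use that in auto)
  show "\<exists>s. least (order_of quot) s (Upper (order_of quot) {x, y})"
    if "x \<in> carrier (order_of quot)" "y \<in> carrier (order_of quot)" for x y
  proof -
    from that obtain u v where uv: "u \<in> C" "v \<in> C" "x = rep u" "y = rep v"
      by (auto simp: order_of_def quot_carrier)
    have "least (order_of quot) (rep (\<lambda>k. max (u k) (v k))) (Upper (order_of quot) {x, y})"
    proof (rule least_UpperI)
      fix z assume z: "z \<in> carrier (order_of quot)" "x \<sqsubseteq>\<^bsub>order_of quot\<^esub> z" "y \<sqsubseteq>\<^bsub>order_of quot\<^esub> z"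
      then obtain w where w: "w \<in> C" "z = rep w" by (auto simp: order_of_def quot_carrier)
      have "N (\<lambda>k. max 0 (u k - w k)) = 0" "N (\<lambda>k. max 0 (v k - w k)) = 0"
        using z w uv by (simp_all add: order_of_def quot_leq)
      then have "leq quot (rep (\<lambda>k. max (u k) (v k))) (rep w)"
        by (rule leqI) (use uv w in \<open>auto intro!: mem\<close>)
      then show "rep (\<lambda>k. max (u k) (v k)) \<sqsubseteq>\<^bsub>order_of quot\<^esub> z"
        using w by (simp add: order_of_def)
    qed (use uv that in \<open>simp_all add: order_of_def leqI0 rep_in_quot max_mem\<close>)
    then show ?thesis by blast
  qed
  show "\<exists>s. greatest (order_of quot) s (Lower (order_of quot) {x, y})"
    if "x \<in> carrier (order_of quot)" "y \<in> carrier (order_of quot)" for x y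
  proof -
    from that obtain u v where uv: "u \<in> C" "v \<in> C" "x = rep u" "y = rep v"
      by (auto simp: order_of_def quot_carrier)
    have "greatest (order_of quot) (rep (\<lambda>k. min (u k) (v k))) (Lower (order_of quot) {x, y})"
    proof (rule greatest_LowerI)
      fix z assume z: "z \<in> carrier (order_of quot)" "z \<sqsubseteq>\<^bsub>order_of quot\<^esub> x" "z \<sqsubseteq>\<^bsub>order_of quot\<^esub> y"
      then obtain w where w: "w \<in> C" "z = rep w" by (auto simp: order_of_def quot_carrier)
      have "N (\<lambda>k. max 0 (w k - u k)) = 0" "N (\<lambda>k. max 0 (w k - v k)) = 0"
        using z w uv by (simp_all add: order_of_def quot_leq)
      then have "leq quot (rep w) (rep (\<lambda>k. min (u k) (v k)))"
        by (rule leqI) (use uv w in \<open>auto intro!: mem\<close>)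
      then show "z \<sqsubseteq>\<^bsub>order_of quot\<^esub> rep (\<lambda>k. min (u k) (v k))"
        using w by (simp add: order_of_def)
    qed (use uv that in \<open>simp_all add: order_of_def leqI0 rep_in_quot min_mem\<close>)
    then show ?thesis by blast
  qed
  fix x y assume "x \<in> carrier (order_of quot)" "y \<in> carrier (order_of quot)"
  then obtain u v where uv: "u \<in> C" "v \<in> C" "x = rep u" "y = rep v"
    by (auto simp: order_of_def quot_carrier)
  show "x .=\<^bsub>order_of quot\<^esub> x" by (simp add: order_of_def)
  show "x \<sqsubseteq>\<^bsub>order_of quot\<^esub> x" using uv by (simp add: order_of_def leqI0)
  show "y .=\<^bsub>order_of quot\<^esub> x" if "x .=\<^bsub>order_of quot\<^esub> y" using that by (simp add: order_of_def)
  show "x .=\<^bsub>order_of quot\<^esub> y" if le: "x \<sqsubseteq>\<^bsub>order_of quot\<^esub> y" "y \<sqsubseteq>\<^bsub>order_of quot\<^esub> x"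
  proof -
    have n: "N (\<lambda>k. max 0 (u k - v k)) = 0" "N (\<lambda>k. max 0 (v k - u k)) = 0"
      using le uv by (auto simp: order_of_def quot_leq)
    have "N (\<lambda>k. u k - v k) = 0"
      by (rule null_le_add[OF n]) (use uv in \<open>auto intro!: mem\<close>)
    then show ?thesis using uv by (simp add: order_of_def rep_eq_iff)
  qed
  fix z assume "z \<in> carrier (order_of quot)"
  then obtain w where w: "w \<in> C" "z = rep w"
    by (auto simp: order_of_def quot_carrier)
  show "x .=\<^bsub>order_of quot\<^esub> z" if "x .=\<^bsub>order_of quot\<^esub> y" "y .=\<^bsub>order_of quot\<^esub> z"
    using that by (simp add: order_of_def)
  show "x \<sqsubseteq>\<^bsub>order_of quot\<^esub> z" if le: "x \<sqsubseteq>\<^bsub>order_of quot\<^esub> y" "y \<sqsubseteq>\<^bsub>order_of quot\<^esub> z"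
  proof -
    have n: "N (\<lambda>k. max 0 (u k - v k)) = 0" "N (\<lambda>k. max 0 (v k - w k)) = 0"
      using le uv w by (auto simp: order_of_def quot_leq)
    then show ?thesis
      using leqI[OF n, of u w] uv w by (auto simp: order_of_def mem)
  qed
qed (auto simp: order_of_def)

lemma vector_lattice_quot: "vector_lattice quot"
proof (intro vector_lattice.intro module_quot lattice_quot)
  have "N (\<lambda>k. max 0 (a * u k - a * v k)) = 0" if "N (\<lambda>k. max 0 (u k - v k)) = 0" "a \<ge> 0" "u \<in> C" "v \<in> C" for a u v
  proof -
    have "(\<lambda>k. max 0 (a * u k - a * v k)) = (\<lambda>k. a * max 0 (u k - v k))"
      using that by (auto simp: max_mult_distrib_left algebra_simps)
    then show ?thesis using that N_scale[of "\<lambda>k. max 0 (u k - v k)" a] by (simp add: mem)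
  qed
  then show "vector_lattice_axioms quot"
    unfolding vector_lattice_axioms_def by (auto simp: quot_carrier quot_simps mem)
qed

interpretation quot: vector_lattice quot
  by (rule vector_lattice_quot)

lemma quot_minus: "u \<in> C \<Longrightarrow> \<ominus>\<^bsub>quot\<^esub> rep u = rep (\<lambda>k. - u k)"
  by (simp add: quot.minus_eq_scale rep_in_quot quot_smult)

lemma quot_diff: "u \<in> C \<Longrightarrow> v \<in> C \<Longrightarrow> rep u \<ominus>\<^bsub>quot\<^esub> rep v = rep (\<lambda>k. u k - v k)"
  by (simp add: a_minus_def quot_minus quot_add mem)

lemma quot_pos_part:
  assumes u: "u \<in> C"
  shows "pos_part quot (rep u) = rep (\<lambda>k. max 0 (u k))"
  unfolding pos_part_def
proof (rule quot.join_eqI)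
  have "max 0 (a - max 0 a) = 0" "max 0 (0 - max 0 a) = 0" for a :: real by auto
  then show "leq quot (rep u) (rep (\<lambda>k. max 0 (u k)))" "leq quot \<zero>\<^bsub>quot\<^esub> (rep (\<lambda>k. max 0 (u k)))"
    using u by (simp_all only: quot_leq quot_zero mem N_zero)
  fix x assume x: "x \<in> carrier quot" "leq quot (rep u) x" "leq quot \<zero>\<^bsub>quot\<^esub> x"
  then obtain w where w: "w \<in> C" "x = rep w" by (auto simp: quot_carrier)
  then have n: "N (\<lambda>k. max 0 (u k - w k)) = 0" "N (\<lambda>k. max 0 (0 - w k)) = 0"
    using x u by (auto simp: quot_leq quot_zero mem)
  have "N (\<lambda>k. max 0 (max 0 (u k) - w k)) = 0"
    by (rule null_le_add[OF n]) (use u w in \<open>auto intro!: mem\<close>)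
  then show "leq quot (rep (\<lambda>k. max 0 (u k))) x"
    using u w by (simp add: quot_leq mem)
qed (use u in \<open>auto simp: quot_zero intro!: rep_in_quot mem\<close>)

lemma quot_modulus: "u \<in> C \<Longrightarrow> modulus quot (rep u) = rep (\<lambda>k. \<bar>u k\<bar>)"
proof -
  assume u: "u \<in> C"
  have "(\<lambda>k. max 0 (u k) + max 0 (- u k)) = (\<lambda>k. \<bar>u k\<bar>)" by auto
  then show ?thesis using u
    by (simp add: quot.modulus_eq rep_in_quot quot_minus quot_pos_part quot_add mem)
qed

lemma normed_vector_lattice_quot: "normed_vector_lattice quot"
proof (intro normed_vector_lattice.intro vector_lattice_quot)
  \<comment> \<open>Pointwise, |u| is at most |v| plus the positive part of |u| - |v|, and the
    latter is null by assumption.\<close>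
  have mono: "N u \<le> N v" if "N (\<lambda>k. max 0 (\<bar>u k\<bar> - \<bar>v k\<bar>)) = 0" "u \<in> C" "v \<in> C" for u v
    using N_le_add[of u v "\<lambda>k. max 0 (\<bar>u k\<bar> - \<bar>v k\<bar>)"] that by (auto simp: mem)
  show "normed_vector_lattice_axioms quot"
    unfolding normed_vector_lattice_axioms_def
    by (auto simp: quot_carrier quot_simps mem N_nonneg rep_eq_iff N_scale N_add quot_modulus
        intro: mono)
qed

lemma quot_dist: "u \<in> C \<Longrightarrow> v \<in> C \<Longrightarrow> nrm_dist quot (rep u) (rep v) = N (\<lambda>k. u k - v k)"
  by (simp add: nrm_dist_def quot_diff quot_nrm mem rep_in_quot)

theorem separable_banach_lattice_quot: "separable_banach_lattice quot"
proof -
  interpret M: Metric_space "carrier quot" "nrm_dist quot"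
    by (rule normed_vector_lattice.Metric_space_nrm_dist[OF normed_vector_lattice_quot])
  have "M.mcomplete"
    unfolding M.mcomplete_def
  proof (intro allI impI)
    fix s assume s: "M.MCauchy s"
    then have "range s \<subseteq> carrier quot" by (simp add: M.MCauchy_def)
    then have "\<forall>n. \<exists>u\<in>C. s n = rep u" unfolding quot_carrier[symmetric] by blast
    then obtain t where t: "\<And>n. t n \<in> C" "\<And>n. s n = rep (t n)" by metis
    have "\<exists>m. \<forall>i j. m \<le> i \<longrightarrow> m \<le> j \<longrightarrow> N (\<lambda>k. t i k - t j k) < e" if "e > 0" for e
      using s that by (simp add: M.MCauchy_def t quot_dist)
    then have "\<exists>m. \<forall>i\<ge>m. \<forall>j\<ge>m. N (\<lambda>k. t i k - t j k) < e" if "e > 0" for e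
      using that by meson
    from N_complete[OF t(1) this] obtain u where u: "u \<in> C" "\<forall>e>0. \<exists>m. \<forall>i\<ge>m. N (\<lambda>k. t i k - u k) < e"
      by blast
    then have "limitin M.mtopology s (rep u) sequentially"
      by (simp add: M.limitin_metric t quot_dist rep_in_quot eventually_sequentially)
    then show "\<exists>x. limitin M.mtopology s x sequentially" by blast
  qed
  moreover have "separable_space M.mtopology"
  proof -
    obtain D where D: "D \<subseteq> C" "countable D" "\<And>u e. u \<in> C \<Longrightarrow> e > 0 \<Longrightarrow> \<exists>d\<in>D. N (\<lambda>k. u k - d k) < e"
      using N_separable by blast
    have "carrier quot \<subseteq> M.mtopology closure_of (rep ` D)"
    proof
      fix x assume "x \<in> carrier quot"
      then obtain u where u: "u \<in> C" "x = rep u" by (auto simp: quot_carrier)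
      have "\<exists>y\<in>rep ` D. y \<in> M.mball x e" if "e > 0" for e
        using D(3)[OF u(1) that] D(1) u by (auto simp: quot_dist rep_in_quot subset_iff)
      then show "x \<in> M.mtopology closure_of (rep ` D)"
        using u by (auto simp: M.metric_closure_of rep_in_quot)
    qed
    moreover have "M.mtopology closure_of (rep ` D) \<subseteq> carrier quot"
      using closure_of_subset_topspace[of M.mtopology] by simp
    moreover have "rep ` D \<subseteq> carrier quot" using D(1) by (auto intro: rep_in_quot)
    ultimately show ?thesis
      unfolding separable_space_def using D(2) by (intro exI[of _ "rep ` D"]) auto
  qed
  ultimately show ?thesis
    using normed_vector_lattice_quot
    by (simp add: separable_banach_lattice_def banach_lattice_def banach_lattice_axioms_def
        separable_banach_lattice_axioms_def)
qed

text \<open>Linearity holds pointwise, but positive parts need to be respected only up to null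
  functions. Joins and meets follow, being expressible by sums, differences and positive
  parts.\<close>

theorem lattice_embedding_quot:
  assumes A: "normed_vector_lattice A" and J: "\<And>x. x \<in> carrier A \<Longrightarrow> J x \<in> C"
    and add: "\<And>x y k. x \<in> carrier A \<Longrightarrow> y \<in> carrier A \<Longrightarrow> J (x \<oplus>\<^bsub>A\<^esub> y) k = J x k + J y k"
    and scale: "\<And>a x k. x \<in> carrier A \<Longrightarrow> J (a \<odot>\<^bsub>A\<^esub> x) k = a * J x k"
    and pos: "\<And>x. x \<in> carrier A \<Longrightarrow> N (\<lambda>k. J (pos_part A x) k - max 0 (J x k)) = 0"
    and nrm: "\<And>x. x \<in> carrier A \<Longrightarrow> N (J x) = nrm A x"
  shows "lattice_embedding A quot (\<lambda>x. rep (J x))"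
proof -
  interpret A: normed_vector_lattice A by (rule A)
  have r_add: "rep (J (x \<oplus>\<^bsub>A\<^esub> y)) = rep (J x) \<oplus>\<^bsub>quot\<^esub> rep (J y)"
    if "x \<in> carrier A" "y \<in> carrier A" for x y
  proof -
    have "J (x \<oplus>\<^bsub>A\<^esub> y) = (\<lambda>k. J x k + J y k)" using add that by auto
    then show ?thesis using that by (simp add: quot_add J)
  qed
  have r_scale: "rep (J (a \<odot>\<^bsub>A\<^esub> x)) = a \<odot>\<^bsub>quot\<^esub> rep (J x)" if "x \<in> carrier A" for a x
  proof -
    have "J (a \<odot>\<^bsub>A\<^esub> x) = (\<lambda>k. a * J x k)" using scale that by auto
    then show ?thesis using that by (simp add: quot_smult J)
  qed
  have r_pos: "rep (J (pos_part A x)) = pos_part quot (rep (J x))" if "x \<in> carrier A" for x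
    using pos[OF that] that by (simp add: quot_pos_part J mem rep_eq_iff)
  have r_diff: "rep (J (x \<ominus>\<^bsub>A\<^esub> y)) = rep (J x) \<ominus>\<^bsub>quot\<^esub> rep (J y)"
    if "x \<in> carrier A" "y \<in> carrier A" for x y
    using that by (simp add: a_minus_def A.minus_eq_scale quot.minus_eq_scale r_add r_scale J rep_in_quot)
  show ?thesis
    unfolding lattice_embedding_def
    by (auto simp: A.join_eq_pos_part A.meet_eq_pos_part quot.join_eq_pos_part quot.meet_eq_pos_part
        r_add r_scale r_pos r_diff J rep_in_quot quot_nrm nrm)
qed

end

section \<open>Limits superior of seminorms\<close>

text \<open>Syntax for the vector lattice operations with rational scalars. The point is
  countability of the type: the values of the terms serve as the countable dense set.\<close>

datatype lattice_term =
  Generator nat | Plus lattice_term lattice_term | Scale rat lattice_term | Pos lattice_term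

instance lattice_term :: countable
  by countable_datatype

primrec term_value :: "(nat \<Rightarrow> 'k \<Rightarrow> real) \<Rightarrow> lattice_term \<Rightarrow> 'k \<Rightarrow> real" where
  "term_value g (Generator n) = g n"
| "term_value g (Plus s t) = (\<lambda>k. term_value g s k + term_value g t k)"
| "term_value g (Scale q t) = (\<lambda>k. of_rat q * term_value g t k)"
| "term_value g (Pos t) = (\<lambda>k. max 0 (term_value g t k))"

text \<open>The premise of \<open>\<nu>_mono\<close> concerns only the indices of level
  \<open>n\<close>, so \<open>\<nu> n u\<close> depends only on the restriction of \<open>u\<close>
  to that level.\<close>

locale seminorm_sequence =
  fixes lev :: "'k \<Rightarrow> nat" and \<nu> :: "nat \<Rightarrow> ('k \<Rightarrow> real) \<Rightarrow> real"
  assumes \<nu>_add: "\<nu> n (\<lambda>k. u k + v k) \<le> \<nu> n u + \<nu> n v"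
    and \<nu>_scale: "\<nu> n (\<lambda>k. a * u k) = \<bar>a\<bar> * \<nu> n u"
    and \<nu>_mono: "(\<And>k. lev k = n \<Longrightarrow> \<bar>u k\<bar> \<le> \<bar>v k\<bar>) \<Longrightarrow> \<nu> n u \<le> \<nu> n v"
begin

definition bdd_funs :: "('k \<Rightarrow> real) set" where
  "bdd_funs = {u. \<exists>c. \<forall>n. \<nu> n u \<le> c}"

text \<open>The limit superior of \<open>\<nu> n u\<close>, as an infimum of eventual upper bounds.\<close>

definition N :: "('k \<Rightarrow> real) \<Rightarrow> real" where
  "N u = Inf {c. \<forall>\<^sub>F n in sequentially. \<nu> n u \<le> c}"

lemma \<nu>_nonneg: "0 \<le> \<nu> n u"
  using \<nu>_mono[of n "\<lambda>k. 0 * u k" u] \<nu>_scale[of n 0 u] by simp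

lemma \<nu>_zero: "\<nu> n (\<lambda>k. 0) = 0"
  using \<nu>_scale[of n 0 "\<lambda>k. 0"] by simp

lemma \<nu>_cong: "(\<And>k. lev k = n \<Longrightarrow> u k = v k) \<Longrightarrow> \<nu> n u = \<nu> n v"
  by (intro antisym \<nu>_mono) auto

lemma \<nu>_diff_commute: "\<nu> n (\<lambda>k. u k - v k) = \<nu> n (\<lambda>k. v k - u k)"
  by (intro antisym \<nu>_mono) auto

lemma \<nu>_triangle: "\<nu> n (\<lambda>k. u k - w k) \<le> \<nu> n (\<lambda>k. u k - v k) + \<nu> n (\<lambda>k. v k - w k)"
  using \<nu>_add[of n "\<lambda>k. u k - v k" "\<lambda>k. v k - w k"] by simp

lemma bound_nonneg:
  assumes "\<forall>\<^sub>F n in sequentially. \<nu> n u \<le> c"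
  shows "0 \<le> c"
proof -
  obtain n where "\<nu> n u \<le> c" using assms by (auto simp: eventually_sequentially)
  then show ?thesis using \<nu>_nonneg[of n u] by linarith
qed

lemma limsup_le: "\<forall>\<^sub>F n in sequentially. \<nu> n u \<le> c \<Longrightarrow> N u \<le> c"
  unfolding N_def by (rule cInf_lower) (auto intro!: bdd_belowI[of _ 0] bound_nonneg)

lemma limsup_less_imp:
  assumes u: "u \<in> bdd_funs" and c: "N u < c"
  shows "\<forall>\<^sub>F n in sequentially. \<nu> n u \<le> c"
proof -
  have "{c. \<forall>\<^sub>F n in sequentially. \<nu> n u \<le> c} \<noteq> {}"
    using u unfolding bdd_funs_def by (auto intro: always_eventually)
  then obtain d where "\<forall>\<^sub>F n in sequentially. \<nu> n u \<le> d" "d < c"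
    using cInf_lessD[of "{c. \<forall>\<^sub>F n in sequentially. \<nu> n u \<le> c}" c] c by (auto simp: N_def)
  then show ?thesis by (auto elim: eventually_mono)
qed

lemma le_limsup:
  assumes "u \<in> bdd_funs" "\<forall>\<^sub>F n in sequentially. c \<le> \<nu> n u"
  shows "c \<le> N u"
proof (rule ccontr)
  assume "\<not> c \<le> N u"
  then obtain d where d: "N u < d" "d < c" using dense by (metis not_le)
  have "\<forall>\<^sub>F n in sequentially. False"
    using limsup_less_imp[OF assms(1) d(1)] assms(2) by eventually_elim (use d in linarith)
  then show False by simp
qed

lemma limsup_nonneg: "u \<in> bdd_funs \<Longrightarrow> 0 \<le> N u"
  by (rule le_limsup) (simp_all add: \<nu>_nonneg)

lemma bdd_funs_zero: "(\<lambda>k. 0) \<in> bdd_funs"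
  by (auto simp: bdd_funs_def \<nu>_zero)

lemma bdd_funs_add: "u \<in> bdd_funs \<Longrightarrow> v \<in> bdd_funs \<Longrightarrow> (\<lambda>k. u k + v k) \<in> bdd_funs"
proof -
  assume "u \<in> bdd_funs" "v \<in> bdd_funs"
  then obtain c d where "\<And>n. \<nu> n u \<le> c" "\<And>n. \<nu> n v \<le> d" by (auto simp: bdd_funs_def)
  then have "\<nu> n (\<lambda>k. u k + v k) \<le> c + d" for n
    using \<nu>_add[of n u v] by (meson add_mono order_trans)
  then show ?thesis by (auto simp: bdd_funs_def)
qed

lemma bdd_funs_scale: "u \<in> bdd_funs \<Longrightarrow> (\<lambda>k. a * u k) \<in> bdd_funs"
  unfolding bdd_funs_def mem_Collect_eq \<nu>_scale by (metis abs_ge_zero mult_left_mono)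

lemma bdd_funs_mono: "v \<in> bdd_funs \<Longrightarrow> (\<And>k. \<bar>u k\<bar> \<le> \<bar>v k\<bar>) \<Longrightarrow> u \<in> bdd_funs"
  unfolding bdd_funs_def by (auto intro: order_trans[OF \<nu>_mono])

lemma bdd_funs_diff: "u \<in> bdd_funs \<Longrightarrow> v \<in> bdd_funs \<Longrightarrow> (\<lambda>k. u k - v k) \<in> bdd_funs"
  using bdd_funs_add[OF _ bdd_funs_scale[of v "-1"], of u] by simp

lemma bdd_funs_pos: "u \<in> bdd_funs \<Longrightarrow> (\<lambda>k. max 0 (u k)) \<in> bdd_funs"
  by (erule bdd_funs_mono) auto

lemma limsup_add:
  assumes "u \<in> bdd_funs" "v \<in> bdd_funs"
  shows "N (\<lambda>k. u k + v k) \<le> N u + N v"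
proof (rule field_le_epsilon)
  fix e :: real assume "e > 0"
  then have "N u < N u + e / 2" "N v < N v + e / 2" by auto
  note limsup_less_imp[OF assms(1) this(1)] limsup_less_imp[OF assms(2) this(2)]
  then have "\<forall>\<^sub>F n in sequentially. \<nu> n (\<lambda>k. u k + v k) \<le> N u + N v + e"
  proof eventually_elim
    case (elim n)
    then show ?case using \<nu>_add[of n u v] by simp
  qed
  then show "N (\<lambda>k. u k + v k) \<le> N u + N v + e" by (rule limsup_le)
qed

lemma limsup_mono:
  assumes v: "v \<in> bdd_funs" and le: "\<And>k. \<bar>u k\<bar> \<le> \<bar>v k\<bar>"
  shows "N u \<le> N v"
proof (rule field_le_epsilon)
  fix e :: real assume "e > 0"
  then have "N v < N v + e" by simp
  from limsup_less_imp[OF v this] have "\<forall>\<^sub>F n in sequentially. \<nu> n u \<le> N v + e"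
    by eventually_elim (use \<nu>_mono[of _ u v] le in \<open>auto intro: order_trans\<close>)
  then show "N u \<le> N v + e" by (rule limsup_le)
qed

lemma limsup_scale:
  assumes u: "u \<in> bdd_funs"
  shows "N (\<lambda>k. a * u k) = \<bar>a\<bar> * N u"
proof -
  have le: "N (\<lambda>k. b * v k) \<le> \<bar>b\<bar> * N v" if v: "v \<in> bdd_funs" and b: "b \<noteq> 0" for b v
  proof (rule field_le_epsilon)
    fix e :: real assume "e > 0"
    then have "N v < N v + e / \<bar>b\<bar>" using b by simp
    from limsup_less_imp[OF v this]
    have "\<forall>\<^sub>F n in sequentially. \<nu> n (\<lambda>k. b * v k) \<le> \<bar>b\<bar> * N v + e"
    proof eventually_elim
      case (elim n)
      then have "\<bar>b\<bar> * \<nu> n v \<le> \<bar>b\<bar> * (N v + e / \<bar>b\<bar>)" by (intro mult_left_mono) auto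
      then show ?case using b by (simp add: \<nu>_scale distrib_left)
    qed
    then show "N (\<lambda>k. b * v k) \<le> \<bar>b\<bar> * N v + e" by (rule limsup_le)
  qed
  show ?thesis
  proof (cases "a = 0")
    case True
    have "N (\<lambda>k. 0) \<le> 0" by (rule limsup_le) (simp add: \<nu>_zero)
    then show ?thesis using True limsup_nonneg[OF bdd_funs_zero] by simp
  next
    case False
    have "N (\<lambda>k. inverse a * (a * u k)) \<le> \<bar>inverse a\<bar> * N (\<lambda>k. a * u k)"
      by (rule le) (use False u bdd_funs_scale in auto)
    then have "\<bar>a\<bar> * N u \<le> N (\<lambda>k. a * u k)"
      using False by (simp add: field_simps)
    then show ?thesis using le[OF u False] by simp
  qed
qed

lemma limsup_diff_commute: "N (\<lambda>k. u k - v k) = N (\<lambda>k. v k - u k)"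
  unfolding N_def using \<nu>_diff_commute[of _ u v] by simp

lemma limsup_triangle:
  assumes "u \<in> bdd_funs" "v \<in> bdd_funs" "w \<in> bdd_funs"
  shows "N (\<lambda>k. u k - w k) \<le> N (\<lambda>k. u k - v k) + N (\<lambda>k. v k - w k)"
  using limsup_add[of "\<lambda>k. u k - v k" "\<lambda>k. v k - w k"] assms by (simp add: bdd_funs_diff)

text \<open>The right-hand side is the exact sum of \<open>(1/2) ^ i\<close> over j \<le> i < l,
  which makes the induction go through.\<close>

lemma \<nu>_telescope:
  assumes "j \<le> l" "\<And>i. j \<le> i \<Longrightarrow> i < l \<Longrightarrow> \<nu> n (\<lambda>k. t i k - t (Suc i) k) \<le> (1/2) ^ i"
  shows "\<nu> n (\<lambda>k. t j k - t l k) \<le> 2 * (1/2) ^ j - 2 * (1/2) ^ l"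
  using assms
proof (induction l rule: dec_induct)
  case base
  then show ?case by (simp add: \<nu>_zero)
next
  case (step l)
  have "\<nu> n (\<lambda>k. t j k - t l k) \<le> 2 * (1/2) ^ j - 2 * (1/2) ^ l"
    using step by simp
  moreover have "\<nu> n (\<lambda>k. t l k - t (Suc l) k) \<le> (1/2) ^ l"
    using step by simp
  ultimately show ?case using \<nu>_triangle[of n "t j" "t (Suc l)" "t l"] by simp
qed

text \<open>
  Different levels do not interact under \<open>\<nu>\<close>.  Hence the limit can be glued together from the
  members of a fast Cauchy sequence, where \<open>J n\<close> says which member is used at level \<open>n\<close>.
\<close>

theorem limsup_complete:
  assumes s: "\<And>n::nat. s n \<in> bdd_funs"
    and cauchy: "\<And>e. e > 0 \<Longrightarrow> \<exists>m. \<forall>i\<ge>m. \<forall>j\<ge>m. N (\<lambda>k. s i k - s j k) < e"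
  shows "\<exists>u\<in>bdd_funs. \<forall>e>0. \<exists>m. \<forall>i\<ge>m. N (\<lambda>k. s i k - u k) < e"
proof -
  have "\<forall>l. \<exists>m. \<forall>i\<ge>m. \<forall>j\<ge>m. N (\<lambda>k. s i k - s j k) < (1/2) ^ l"
    using cauchy by simp
  then obtain m where m: "\<And>l i j. m l \<le> i \<Longrightarrow> m l \<le> j \<Longrightarrow> N (\<lambda>k. s i k - s j k) < (1/2) ^ l"
    by metis
  \<comment> \<open>Summing the thresholds makes them monotone: both \<open>M l\<close> and
    \<open>M (Suc l)\<close> are at least \<open>m l\<close>, so consecutive members of the
    subsequence are close.\<close>
  define M where "M l = (\<Sum>i\<le>l. m i)" for l
  have M: "m i \<le> M l" if "i \<le> l" for i l
    unfolding M_def by (rule member_le_sum) (use that in auto)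
  define t where "t l = s (M l)" for l
  have t: "t l \<in> bdd_funs" for l using s by (simp add: t_def)
  have ev: "\<forall>\<^sub>F n in sequentially. \<nu> n (\<lambda>k. t l k - t (Suc l) k) \<le> (1/2) ^ l" for l
  proof (rule limsup_less_imp[OF bdd_funs_diff[OF t t]])
    show "N (\<lambda>k. t l k - t (Suc l) k) < (1/2) ^ l"
      unfolding t_def by (rule m) (simp_all add: M)
  qed
  \<comment> \<open>The members up to index \<open>j\<close> may be trusted at level
    \<open>n\<close> if all consecutive differences before \<open>j\<close> are already small at
    that level. The cap \<open>j \<le> n\<close> keeps the set finite, and 0 always belongs to
    it.\<close>
  define S where "S n = {j. j \<le> n \<and> (\<forall>i<j. \<nu> n (\<lambda>k. t i k - t (Suc i) k) \<le> (1/2) ^ i)}" for n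
  define J where "J n = Max (S n)" for n
  have S: "finite (S n)" "0 \<in> S n" for n by (auto simp: S_def)
  have J: "J n \<in> S n" for n unfolding J_def using S[of n] Max_in by blast
  define u where "u k = t (J (lev k)) k" for k
  \<comment> \<open>This holds at each single level, not just eventually. For \<open>j = 0\<close>
    it covers all levels, which gives boundedness of \<open>u\<close>.\<close>
  have near: "\<nu> n (\<lambda>k. t j k - u k) \<le> 2 * (1/2) ^ j" if "j \<le> J n" for j n
  proof -
    have "\<nu> n (\<lambda>k. t j k - u k) = \<nu> n (\<lambda>k. t j k - t (J n) k)"
      by (rule \<nu>_cong) (simp add: u_def)
    also have "\<dots> \<le> 2 * (1/2) ^ j - 2 * (1/2) ^ J n"
      by (rule \<nu>_telescope) (use that J[of n] in \<open>auto simp: S_def\<close>)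
    finally show ?thesis by (smt (verit) zero_le_power divide_nonneg_nonneg)
  qed
  have u: "u \<in> bdd_funs"
  proof -
    obtain c where c: "\<And>n. \<nu> n (t 0) \<le> c" using t[of 0] by (auto simp: bdd_funs_def)
    have "\<nu> n u \<le> c + 2" for n
    proof -
      have "\<nu> n (\<lambda>k. t 0 k + -1 * (t 0 k - u k)) \<le> \<nu> n (t 0) + \<nu> n (\<lambda>k. t 0 k - u k)"
        using \<nu>_add[of n "t 0" "\<lambda>k. -1 * (t 0 k - u k)"] \<nu>_scale[of n "-1" "\<lambda>k. t 0 k - u k"] by simp
      then show ?thesis using near[of 0 n] c[of n] by simp
    qed
    then show ?thesis by (auto simp: bdd_funs_def)
  qed
  \<comment> \<open>For fixed \<open>j\<close>, membership of \<open>j\<close> in \<open>S n\<close>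
    amounts to finitely many conditions that hold eventually, so \<open>J n\<close> tends to
    infinity.\<close>
  have lim: "N (\<lambda>k. t j k - u k) \<le> 2 * (1/2) ^ j" for j
  proof (rule limsup_le)
    have "\<forall>\<^sub>F n in sequentially. \<forall>i\<in>{..<j}. \<nu> n (\<lambda>k. t i k - t (Suc i) k) \<le> (1/2) ^ i"
      using ev by (intro eventually_ball_finite) auto
    then show "\<forall>\<^sub>F n in sequentially. \<nu> n (\<lambda>k. t j k - u k) \<le> 2 * (1/2) ^ j"
      using eventually_ge_at_top[of j]
    proof eventually_elim
      case (elim n)
      then have "j \<in> S n" by (simp add: S_def)
      then show ?case using S[of n] by (intro near) (simp add: J_def)
    qed
  qed
  have "\<exists>m. \<forall>i\<ge>m. N (\<lambda>k. s i k - u k) < e" if "e > 0" for e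
  proof -
    from that real_arch_pow_inv[of "e / 3" "1/2"] obtain l :: nat where l: "(1/2) ^ l < e / 3"
      by auto
    have "N (\<lambda>k. s i k - u k) < e" if "i \<ge> M l" for i
    proof -
      have "N (\<lambda>k. s i k - t l k) < (1/2) ^ l"
        unfolding t_def by (rule m) (use M[of l l] that in auto)
      then show ?thesis using limsup_triangle[OF s[of i] t[of l] u] lim[of l] l by simp
    qed
    then show ?thesis by blast
  qed
  then show ?thesis using u by blast
qed

text \<open>Passing from \<open>bdd_funs\<close> to this closure secures separability; completeness
  is inherited because the closure is closed under limits for \<open>N\<close>.\<close>

definition term_closure :: "(nat \<Rightarrow> 'k \<Rightarrow> real) \<Rightarrow> ('k \<Rightarrow> real) set" where
  "term_closure g = {u \<in> bdd_funs. \<forall>e>0. \<exists>t. N (\<lambda>k. u k - term_value g t k) < e}"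

lemma term_value_bdd: "(\<And>n. g n \<in> bdd_funs) \<Longrightarrow> term_value g t \<in> bdd_funs"
  by (induction t) (auto intro: bdd_funs_add bdd_funs_scale bdd_funs_pos)

theorem seminormed_function_lattice_term_closure:
  assumes g: "\<And>n. g n \<in> bdd_funs"
  shows "seminormed_function_lattice (term_closure g) N"
proof
  have tv: "term_value g t \<in> bdd_funs" for t using g by (rule term_value_bdd)
  have tc: "term_value g t \<in> term_closure g" for t
    using tv limsup_scale[OF bdd_funs_zero, of 0] by (auto simp: term_closure_def intro!: exI[of _ t])
  have in_bdd: "u \<in> bdd_funs" if "u \<in> term_closure g" for u using that by (simp add: term_closure_def)
  show "(\<lambda>k. 0) \<in> term_closure g" using tc[of "Scale 0 (Generator 0)"] by simp
  show "(\<lambda>k. u k + v k) \<in> term_closure g" if u: "u \<in> term_closure g" and v: "v \<in> term_closure g" for u v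
  proof -
    have "\<exists>t. N (\<lambda>k. (u k + v k) - term_value g t k) < e" if "e > 0" for e
    proof -
      obtain s t where st: "N (\<lambda>k. u k - term_value g s k) < e / 2" "N (\<lambda>k. v k - term_value g t k) < e / 2"
        using u v \<open>e > 0\<close> by (auto simp: term_closure_def dest!: spec[of _ "e / 2"])
      have "N (\<lambda>k. (u k - term_value g s k) + (v k - term_value g t k)) < e"
        using limsup_add[of "\<lambda>k. u k - term_value g s k" "\<lambda>k. v k - term_value g t k"] st u v
        by (simp add: bdd_funs_diff in_bdd tv)
      then show ?thesis by (intro exI[of _ "Plus s t"]) (simp add: algebra_simps)
    qed
    then show ?thesis using u v by (simp add: term_closure_def bdd_funs_add)
  qed
  show "(\<lambda>k. a * u k) \<in> term_closure g" if u: "u \<in> term_closure g" for u a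
  proof -
    have "\<exists>t. N (\<lambda>k. a * u k - term_value g t k) < e" if e: "e > 0" for e
    proof -
      have Nu: "N u \<ge> 0" using limsup_nonneg in_bdd u by blast
      \<comment> \<open>The error budget is halved. Replacing \<open>a\<close> by a rational
        \<open>r\<close> within \<open>d\<close> costs less than \<open>e / 2\<close>; approximating
        \<open>u\<close> by a term within \<open>e / (2 * (\<bar>r\<bar> + 1))\<close> costs at most
        \<open>e / 2\<close>. The summands 1 avoid division by zero.\<close>
      define d where "d = e / (2 * (N u + 1))"
      have d: "d > 0" "d * N u < e / 2" using e Nu by (auto simp: d_def field_simps)
      obtain q where q: "a - d < real_of_rat q" "real_of_rat q < a"
        using of_rat_dense[of "a - d" a] d by auto
      define r where "r = real_of_rat q"
      have r: "a - d < r" "r < a" using q by (simp_all add: r_def)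
      have "e / (2 * (\<bar>r\<bar> + 1)) > 0" using e by (intro divide_pos_pos) auto
      then obtain t where t: "N (\<lambda>k. u k - term_value g t k) < e / (2 * (\<bar>r\<bar> + 1))"
        using u by (auto simp: term_closure_def)
      have ut: "(\<lambda>k. u k - term_value g t k) \<in> bdd_funs" using u by (simp add: in_bdd tv bdd_funs_diff)
      have "N (\<lambda>k. a * u k - r * term_value g t k) = N (\<lambda>k. (a - r) * u k + r * (u k - term_value g t k))"
        by (simp add: algebra_simps)
      also have "\<dots> \<le> \<bar>a - r\<bar> * N u + \<bar>r\<bar> * N (\<lambda>k. u k - term_value g t k)"
        using limsup_add[of "\<lambda>k. (a - r) * u k" "\<lambda>k. r * (u k - term_value g t k)"] u ut
        by (simp add: in_bdd bdd_funs_scale limsup_scale)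
      also have "\<bar>a - r\<bar> * N u \<le> d * N u" using r Nu by (intro mult_right_mono) auto
      also have "d * N u < e / 2" by (rule d)
      also have "\<bar>r\<bar> * N (\<lambda>k. u k - term_value g t k) \<le> \<bar>r\<bar> * (e / (2 * (\<bar>r\<bar> + 1)))"
        using t by (intro mult_left_mono) auto
      also have "\<bar>r\<bar> * (e / (2 * (\<bar>r\<bar> + 1))) \<le> e / 2"
        using e by (simp add: field_simps)
      finally show ?thesis by (intro exI[of _ "Scale q t"]) (simp add: r_def)
    qed
    then show ?thesis using u by (simp add: term_closure_def bdd_funs_scale)
  qed
  show "(\<lambda>k. max 0 (u k)) \<in> term_closure g" if u: "u \<in> term_closure g" for u
  proof -
    have "\<exists>t. N (\<lambda>k. max 0 (u k) - term_value g t k) < e" if "e > 0" for e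
    proof -
      from u that obtain t where t: "N (\<lambda>k. u k - term_value g t k) < e" by (auto simp: term_closure_def)
      have "N (\<lambda>k. max 0 (u k) - max 0 (term_value g t k)) \<le> N (\<lambda>k. u k - term_value g t k)"
        by (rule limsup_mono[OF bdd_funs_diff[OF in_bdd[OF u] tv]]) auto
      then show ?thesis using t by (intro exI[of _ "Pos t"]) simp
    qed
    then show ?thesis using u by (simp add: term_closure_def bdd_funs_pos)
  qed
  show "N (\<lambda>k. u k + v k) \<le> N u + N v" if "u \<in> term_closure g" "v \<in> term_closure g" for u v
    using that by (intro limsup_add in_bdd)
  show "N (\<lambda>k. a * u k) = \<bar>a\<bar> * N u" if "u \<in> term_closure g" for u a
    using that by (intro limsup_scale in_bdd)
  show "N u \<le> N v" if "u \<in> term_closure g" "v \<in> term_closure g" "\<And>k. \<bar>u k\<bar> \<le> \<bar>v k\<bar>" for u v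
    using that by (intro limsup_mono in_bdd)
  show "\<exists>u\<in>term_closure g. \<forall>e>0. \<exists>m. \<forall>i\<ge>m. N (\<lambda>k. s i k - u k) < e"
    if s: "\<And>n::nat. s n \<in> term_closure g"
      and cauchy: "\<And>e. e > 0 \<Longrightarrow> \<exists>m. \<forall>i\<ge>m. \<forall>j\<ge>m. N (\<lambda>k. s i k - s j k) < e" for s
  proof -
    obtain u where u: "u \<in> bdd_funs" "\<And>e. e > 0 \<Longrightarrow> \<exists>m. \<forall>i\<ge>m. N (\<lambda>k. s i k - u k) < e"
      using limsup_complete[OF in_bdd[OF s] cauchy] by blast
    have "\<exists>t. N (\<lambda>k. u k - term_value g t k) < e" if "e > 0" for e
    proof -
      obtain i where i: "N (\<lambda>k. s i k - u k) < e / 2" using u(2)[of "e / 2"] \<open>e > 0\<close> by auto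
      obtain t where t: "N (\<lambda>k. s i k - term_value g t k) < e / 2"
        using s[of i] \<open>e > 0\<close> by (auto simp: term_closure_def dest!: spec[of _ "e / 2"])
      show ?thesis
        using limsup_triangle[OF u(1) in_bdd[OF s[of i]] tv[of t]] i t limsup_diff_commute[of u "s i"]
        by (intro exI[of _ t]) linarith
    qed
    then show ?thesis using u by (auto simp: term_closure_def)
  qed
  show "\<exists>D\<subseteq>term_closure g. countable D \<and> (\<forall>u\<in>term_closure g. \<forall>e>0. \<exists>d\<in>D. N (\<lambda>k. u k - d k) < e)"
    by (intro exI[of _ "range (term_value g)"]) (auto simp: tc, auto simp: term_closure_def)
qed

end

section \<open>Trees of functionals\<close>

text \<open>
  A functional \<open>\<Phi>\<close> is split repeatedly into two summands.  The split along \<open>x\<close> makes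
  \<open>\<Sum> max 0 (\<Phi>\<^sub>i x)\<close>, taken over the current summands, equal to \<open>\<Phi> (x\<^sup>+)\<close>;
  all later splits preserve this.
\<close>

locale functional_tree =
  fixes X :: "'x set" and pos absv :: "'x \<Rightarrow> 'x" and K :: "('x \<Rightarrow> real) set"
    and c :: "nat \<Rightarrow> 'x" and root :: "nat \<Rightarrow> 'x \<Rightarrow> real" and nn :: "'x \<Rightarrow> real"
  assumes K_pos: "\<Phi> \<in> K \<Longrightarrow> x \<in> X \<Longrightarrow> \<Phi> x \<le> \<Phi> (pos x) \<and> 0 \<le> \<Phi> (pos x)"
    and K_mod: "\<Phi> \<in> K \<Longrightarrow> x \<in> X \<Longrightarrow> \<Phi> (absv x) = 2 * \<Phi> (pos x) - \<Phi> x"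
    and K_split: "\<Phi> \<in> K \<Longrightarrow> x \<in> X \<Longrightarrow> \<exists>\<Psi>\<in>K. (\<lambda>y. \<Phi> y - \<Psi> y) \<in> K \<and> \<Psi> x = \<Phi> (pos x)"
    and c: "c n \<in> X" and root: "root m \<in> K"
    and root_le: "x \<in> X \<Longrightarrow> root m (absv x) \<le> nn x"
    and root_norming: "root m (absv (c m)) = nn (c m)"
begin

definition part :: "'x \<Rightarrow> ('x \<Rightarrow> real) \<Rightarrow> 'x \<Rightarrow> real" where
  "part x \<Phi> = (SOME \<Psi>. \<Psi> \<in> K \<and> (\<lambda>y. \<Phi> y - \<Psi> y) \<in> K \<and> \<Psi> x = \<Phi> (pos x))"

lemma part:
  assumes "\<Phi> \<in> K" "x \<in> X"
  shows "part x \<Phi> \<in> K" "(\<lambda>y. \<Phi> y - part x \<Phi> y) \<in> K" "part x \<Phi> x = \<Phi> (pos x)"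
proof -
  have "\<exists>\<Psi>. \<Psi> \<in> K \<and> (\<lambda>y. \<Phi> y - \<Psi> y) \<in> K \<and> \<Psi> x = \<Phi> (pos x)"
    using K_split[OF assms] by blast
  from someI_ex[OF this]
  show "part x \<Phi> \<in> K" "(\<lambda>y. \<Phi> y - part x \<Phi> y) \<in> K" "part x \<Phi> x = \<Phi> (pos x)"
    unfolding part_def by auto
qed

text \<open>The head of the list is the latest branching. Nodes at depth \<open>j\<close> are split
  along \<open>c j\<close>, the same vector in every tree, so the effect for \<open>c j\<close> is
  visible from level \<open>j + 1\<close> on.\<close>

primrec T :: "nat \<Rightarrow> bool list \<Rightarrow> 'x \<Rightarrow> real" where
  "T m [] = root m"
| "T m (b # p) = (if b then part (c (length p)) (T m p)
     else (\<lambda>y. T m p y - part (c (length p)) (T m p) y))"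

lemma T_mem: "T m p \<in> K"
  by (induction p) (auto simp: root part c)

lemma finite_level: "finite {p :: bool list. length p = n}"
  using finite_lists_length_eq[of "UNIV :: bool set" n] by simp

lemma sum_level_Suc:
  "(\<Sum>p | length p = Suc n. f p) = (\<Sum>p | length p = n. f (True # p) + f (False # p) :: real)"
proof -
  have "{p. length p = Suc n} = (#) True ` {p. length p = n} \<union> (#) False ` {p. length p = n}"
    by (auto simp: length_Suc_conv)
  moreover have "(#) True ` {p. length p = n} \<inter> (#) False ` {p. length p = n} = {}" by auto
  ultimately show ?thesis
    by (simp add: sum.union_disjoint finite_level sum.reindex sum.distrib)
qed

lemma sum_T: "(\<Sum>p | length p = n. T m p x) = root m x"
proof (induction n)
  case (Suc n)
  then show ?case by (simp add: sum_level_Suc)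
qed simp

text \<open>At level \<open>j + 1\<close> the \<open>True\<close> child takes the value \<Phi>(x^+)
  \<ge> 0 at x = \<open>c j\<close> and the \<open>False\<close> child the value \<Phi>(x) -
  \<Phi>(x^+) \<le> 0, so their positive parts add up to \<Phi>(x^+). Further splitting cannot
  decrease the sum of positive parts, while positivity of the nodes bounds it by the root value at
  x^+.\<close>

lemma sum_pos_T:
  assumes "j < n"
  shows "(\<Sum>p | length p = n. max 0 (T m p (c j))) = root m (pos (c j))"
  using assms[unfolded Suc_le_eq[symmetric]]
proof (induction n rule: dec_induct)
  case base
  have "max 0 (T m (True # p) (c j)) + max 0 (T m (False # p) (c j)) = T m p (pos (c j))"
    if "length p = j" for p
    using part(3)[OF T_mem c, of j m p] K_pos[OF T_mem c, of m p j] that by simp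
  then show ?case by (simp add: sum_level_Suc sum_T del: T.simps)
next
  case (step n)
  have "(\<Sum>p | length p = n. max 0 (T m p (c j))) \<le> (\<Sum>p | length p = Suc n. max 0 (T m p (c j)))"
    unfolding sum_level_Suc by (rule sum_mono) auto
  moreover have "(\<Sum>p | length p = Suc n. max 0 (T m p (c j))) \<le> (\<Sum>p | length p = Suc n. T m p (pos (c j)))"
    by (rule sum_mono) (use K_pos[OF T_mem c] in auto)
  ultimately show ?case using step.IH by (simp add: sum_T del: T.simps)
qed

text \<open>The largest of the \<open>\<ell>\<^sup>1\<close>-norms on level \<open>n\<close> of the
  first trees. The restriction to \<open>m \<le> n\<close> makes this a maximum of finitely many
  numbers for every \<open>u\<close>, and each tree still counts at all but finitely many
  levels.\<close>

definition \<nu> :: "nat \<Rightarrow> (nat \<times> bool list \<Rightarrow> real) \<Rightarrow> real" where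
  "\<nu> n u = (MAX m\<in>{..n}. \<Sum>p | length p = n. \<bar>u (m, p)\<bar>)"

lemma \<nu>_le_iff: "\<nu> n u \<le> b \<longleftrightarrow> (\<forall>m\<le>n. (\<Sum>p | length p = n. \<bar>u (m, p)\<bar>) \<le> b)"
  unfolding \<nu>_def by (subst Max_le_iff) auto

lemma le_\<nu>: "m \<le> n \<Longrightarrow> (\<Sum>p | length p = n. \<bar>u (m, p)\<bar>) \<le> \<nu> n u"
  using \<nu>_le_iff[of n u "\<nu> n u"] by simp

sublocale seminorm_sequence "\<lambda>(m, p). length p" \<nu>
proof
  show "\<nu> n (\<lambda>k. u k + v k) \<le> \<nu> n u + \<nu> n v" for n u v
    unfolding \<nu>_le_iff
  proof (intro allI impI)
    fix m assume m: "m \<le> n"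
    have "(\<Sum>p | length p = n. \<bar>u (m, p) + v (m, p)\<bar>) \<le>
        (\<Sum>p | length p = n. \<bar>u (m, p)\<bar>) + (\<Sum>p | length p = n. \<bar>v (m, p)\<bar>)"
      unfolding sum.distrib[symmetric] by (rule sum_mono) auto
    also have "\<dots> \<le> \<nu> n u + \<nu> n v" by (intro add_mono le_\<nu> m)
    finally show "(\<Sum>p | length p = n. \<bar>u (m, p) + v (m, p)\<bar>) \<le> \<nu> n u + \<nu> n v" .
  qed
  have le: "\<nu> n (\<lambda>k. a * u k) \<le> \<bar>a\<bar> * \<nu> n u" for n a u
    unfolding \<nu>_le_iff
    by (auto simp: abs_mult simp flip: sum_distrib_left intro!: mult_left_mono le_\<nu>)
  show "\<nu> n (\<lambda>k. a * u k) = \<bar>a\<bar> * \<nu> n u" for n a u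
  proof (cases "a = 0")
    case True
    then show ?thesis by (simp add: \<nu>_def)
  next
    case False
    then show ?thesis
      using le[of n a u] le[of n "inverse a" "\<lambda>k. a * u k"] by (simp add: field_simps)
  qed
  show "\<nu> n u \<le> \<nu> n v" if "\<And>k. (case k of (m, p) \<Rightarrow> length p) = n \<Longrightarrow> \<bar>u k\<bar> \<le> \<bar>v k\<bar>" for n u v
    unfolding \<nu>_le_iff
  proof (intro allI impI)
    fix m assume m: "m \<le> n"
    have "(\<Sum>p | length p = n. \<bar>u (m, p)\<bar>) \<le> (\<Sum>p | length p = n. \<bar>v (m, p)\<bar>)"
      by (rule sum_mono) (use that in auto)
    also have "\<dots> \<le> \<nu> n v" by (rule le_\<nu>[OF m])
    finally show "(\<Sum>p | length p = n. \<bar>u (m, p)\<bar>) \<le> \<nu> n v" .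
  qed
qed

definition J :: "'x \<Rightarrow> nat \<times> bool list \<Rightarrow> real" where
  "J x = (\<lambda>(m, p). T m p x)"

lemma \<nu>_J_le: "x \<in> X \<Longrightarrow> \<nu> n (J x) \<le> nn x"
  unfolding \<nu>_le_iff
proof (intro allI impI)
  fix m assume x: "x \<in> X"
  have "(\<Sum>p | length p = n. \<bar>J x (m, p)\<bar>) \<le> (\<Sum>p | length p = n. T m p (absv x))"
  proof (rule sum_mono)
    fix p
    show "\<bar>J x (m, p)\<bar> \<le> T m p (absv x)"
      using K_pos[OF T_mem x, of m p] K_mod[OF T_mem x, of m p] by (auto simp: J_def abs_if)
  qed
  also have "\<dots> \<le> nn x" using root_le[OF x] by (simp add: sum_T)
  finally show "(\<Sum>p | length p = n. \<bar>J x (m, p)\<bar>) \<le> nn x" .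
qed

lemma J_bdd: "x \<in> X \<Longrightarrow> J x \<in> bdd_funs"
  using \<nu>_J_le by (auto simp: bdd_funs_def)

lemma N_J_le: "x \<in> X \<Longrightarrow> N (J x) \<le> nn x"
  by (rule limsup_le) (simp add: \<nu>_J_le)

text \<open>By |a| = 2 a^+ - a, the \<open>\<ell>\<^sup>1\<close>-norm of \<open>J (c m)\<close>
  over a level of tree \<open>m\<close> equals the root value at |c m| once the level exceeds
  \<open>m\<close>. The root of this tree was chosen to norm \<open>c m\<close>.\<close>

lemma N_J_generator: "N (J (c m)) = nn (c m)"
proof (rule antisym[OF N_J_le[OF c]], rule le_limsup[OF J_bdd[OF c]])
  show "\<forall>\<^sub>F n in sequentially. nn (c m) \<le> \<nu> n (J (c m))"
    using eventually_gt_at_top[of m]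
  proof eventually_elim
    case (elim n)
    have "\<bar>a\<bar> = 2 * max 0 a - a" for a :: real by auto
    then have "(\<Sum>p | length p = n. \<bar>J (c m) (m, p)\<bar>) =
        2 * (\<Sum>p | length p = n. max 0 (T m p (c m))) - (\<Sum>p | length p = n. T m p (c m))"
      by (simp only: J_def prod.case sum_subtractf sum_distrib_left)
    also have "\<dots> = root m (absv (c m))"
      using elim by (simp add: sum_pos_T sum_T K_mod[OF root c])
    finally show ?case using le_\<nu>[of m n "J (c m)"] elim by (simp add: root_norming)
  qed
qed

text \<open>The difference is nonnegative at every node. Beyond level \<open>j\<close> both of its
  terms sum to the root value at the positive part of \<open>c j\<close>, in every tree at once, so
  it vanishes there.\<close>

lemma N_J_pos_generator: "N (\<lambda>k. J (pos (c j)) k - max 0 (J (c j) k)) \<le> 0"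
proof (rule limsup_le)
  show "\<forall>\<^sub>F n in sequentially. \<nu> n (\<lambda>k. J (pos (c j)) k - max 0 (J (c j) k)) \<le> 0"
    using eventually_gt_at_top[of j]
  proof eventually_elim
    case (elim n)
    have "(\<Sum>p | length p = n. \<bar>J (pos (c j)) (m, p) - max 0 (J (c j) (m, p))\<bar>) = 0" for m
    proof -
      have "\<bar>T m p (pos (c j)) - max 0 (T m p (c j))\<bar> = T m p (pos (c j)) - max 0 (T m p (c j))" for p
        using K_pos[OF T_mem c, of m p j] by simp
      then show ?thesis using elim by (simp add: J_def sum_subtractf sum_T sum_pos_T)
    qed
    then show ?case by (simp add: \<nu>_le_iff)
  qed
qed

end

section \<open>The tree map as an isometric lattice homomorphism\<close>

context functional_tree
begin

abbreviation "C \<equiv> term_closure (\<lambda>n. J (c n))"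

sublocale seminormed_function_lattice C N
  by (rule seminormed_function_lattice_term_closure) (simp add: J_bdd c)

text \<open>Stated for an inclusion \<open>i\<close> of a lattice into the index set
  \<open>X\<close>, so that it applies to both summands of a disjoint union. Exactness is known at
  the vectors \<open>c n\<close> and passes to all others by approximation.\<close>

theorem lattice_embedding_J:
  assumes A: "normed_vector_lattice A" and i: "\<And>a. a \<in> carrier A \<Longrightarrow> i a \<in> X"
    and K: "\<And>\<Phi>. \<Phi> \<in> K \<Longrightarrow> pos_fun A (\<lambda>a. \<Phi> (i a))"
    and pos: "\<And>a. a \<in> carrier A \<Longrightarrow> pos (i a) = i (pos_part A a)"
    and nn: "\<And>a. a \<in> carrier A \<Longrightarrow> nn (i a) = nrm A a"
    and dense: "\<And>a e. a \<in> carrier A \<Longrightarrow> e > 0 \<Longrightarrow>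
      \<exists>b n. b \<in> carrier A \<and> c n = i b \<and> nrm A (a \<ominus>\<^bsub>A\<^esub> b) < e"
  shows "lattice_embedding A quot (\<lambda>a. rep (J (i a)))"
proof -
  interpret A: normed_vector_lattice A by (rule A)
  have T_pos: "pos_fun A (\<lambda>a. T m p (i a))" for m p by (rule K[OF T_mem])
  note T_lin = A.pos_fun_linear[OF T_pos]
  have J_diff: "J (i (a \<ominus>\<^bsub>A\<^esub> b)) = (\<lambda>k. J (i a) k - J (i b) k)" if "a \<in> carrier A" "b \<in> carrier A" for a b
    using A.linear_fun_diff[OF T_lin that] by (auto simp: J_def)
  have N_le: "N (J (i a)) \<le> nrm A a" if "a \<in> carrier A" for a
    using N_J_le[OF i[OF that]] nn[OF that] by simp
  have bdd: "J (i a) \<in> bdd_funs" if "a \<in> carrier A" for a using J_bdd i that by blast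
  show ?thesis
  proof (rule lattice_embedding_quot[OF A])
    fix a assume a: "a \<in> carrier A"
    have "\<exists>t. N (\<lambda>k. J (i a) k - term_value (\<lambda>n. J (c n)) t k) < e" if e: "e > 0" for e
    proof -
      from dense[OF a e] obtain b n where b: "b \<in> carrier A" "c n = i b" "nrm A (a \<ominus>\<^bsub>A\<^esub> b) < e" by blast
      then show ?thesis
        using N_le[of "a \<ominus>\<^bsub>A\<^esub> b"] a by (intro exI[of _ "Generator n"]) (simp add: J_diff)
    qed
    then show "J (i a) \<in> C" using bdd[OF a] by (simp add: term_closure_def)
  next
    fix a b k assume "a \<in> carrier A" "b \<in> carrier A"
    then show "J (i (a \<oplus>\<^bsub>A\<^esub> b)) k = J (i a) k + J (i b) k"
      using A.linear_fun_add[OF T_lin] by (auto simp: J_def split: prod.split)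
  next
    fix r a k assume "a \<in> carrier A"
    then show "J (i (r \<odot>\<^bsub>A\<^esub> a)) k = r * J (i a) k"
      using A.linear_fun_scale[OF T_lin] by (auto simp: J_def split: prod.split)
  next
    fix a assume a: "a \<in> carrier A"
    let ?D = "\<lambda>b k. J (i (pos_part A b)) k - max 0 (J (i b) k)"
    have D: "?D b \<in> bdd_funs" if "b \<in> carrier A" for b
      using that by (intro bdd_funs_diff bdd_funs_pos bdd) auto
    have "N (?D a) \<le> 0 + e" if e: "e > 0" for e
    proof -
      from dense[OF a, of "e / 2"] e obtain b n
        where b: "b \<in> carrier A" "c n = i b" "nrm A (a \<ominus>\<^bsub>A\<^esub> b) < e / 2" by auto
      define w where "w = J (i (modulus A (a \<ominus>\<^bsub>A\<^esub> b)))"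
      have w: "w \<in> bdd_funs" "N w < e / 2"
        using bdd N_le[of "modulus A (a \<ominus>\<^bsub>A\<^esub> b)"] a b by (auto simp: w_def A.nrm_modulus)
      have "N (\<lambda>k. \<bar>?D b k\<bar>) \<le> N (?D b)" by (rule limsup_mono[OF D[OF b(1)]]) simp
      also have "\<dots> \<le> 0" using N_J_pos_generator[of n] b by (simp add: pos)
      finally have Db: "N (\<lambda>k. \<bar>?D b k\<bar>) \<le> 0" "(\<lambda>k. \<bar>?D b k\<bar>) \<in> bdd_funs"
        using bdd_funs_mono[OF D[OF b(1)], of "\<lambda>k. \<bar>?D b k\<bar>"] by simp_all
      have sum: "(\<lambda>k. 2 * w k + \<bar>?D b k\<bar>) \<in> bdd_funs"
        by (intro bdd_funs_add bdd_funs_scale w Db)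
      \<comment> \<open>One \<open>w\<close> bounds the change of \<open>J\<close> between
        \<open>a\<close> and \<open>b\<close>, the other the change at their positive parts.\<close>
      have "\<bar>?D a k\<bar> \<le> \<bar>2 * w k + \<bar>?D b k\<bar>\<bar>" for k
      proof -
        obtain m p where k: "k = (m, p)" by (cases k)
        have "\<bar>J (i a) k - J (i b) k\<bar> \<le> w k"
          using A.pos_fun_abs_le[OF T_pos, of "a \<ominus>\<^bsub>A\<^esub> b" m p] a b(1)
          by (simp add: w_def k J_def A.linear_fun_diff[OF T_lin])
        moreover have "\<bar>J (i (pos_part A a)) k - J (i (pos_part A b)) k\<bar> \<le> w k"
          using A.pos_fun_pos_part_diff[OF T_pos a b(1), of m p] by (simp add: w_def k J_def)
        ultimately show ?thesis by linarith
      qed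
      then have "N (?D a) \<le> N (\<lambda>k. 2 * w k + \<bar>?D b k\<bar>)" by (rule limsup_mono[OF sum])
      also have "\<dots> \<le> N (\<lambda>k. 2 * w k) + N (\<lambda>k. \<bar>?D b k\<bar>)"
        by (intro limsup_add bdd_funs_scale w Db)
      also have "\<dots> \<le> 0 + e" using w Db by (simp add: limsup_scale)
      finally show ?thesis .
    qed
    then have "N (?D a) \<le> 0" by (rule field_le_epsilon)
    then show "N (?D a) = 0" using limsup_nonneg[OF D[OF a]] by simp
  next
    fix a assume a: "a \<in> carrier A"
    \<comment> \<open>No root need norm \<open>a\<close> itself. The lower bound passes through a
      nearby dense vector \<open>b\<close>, at the cost of \<open>e / 2\<close> on the way there and
      \<open>e / 2\<close> on the way back.\<close>
    have "nrm A a \<le> N (J (i a)) + e" if e: "e > 0" for e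
    proof -
      from dense[OF a, of "e / 2"] e obtain b n
        where b: "b \<in> carrier A" "c n = i b" "nrm A (a \<ominus>\<^bsub>A\<^esub> b) < e / 2" by auto
      have "nrm A a \<le> nrm A (a \<ominus>\<^bsub>A\<^esub> b) + nrm A b"
        using A.nrm_triangle[of "a \<ominus>\<^bsub>A\<^esub> b" b] a b(1) by (simp add: A.diff_add)
      also have "nrm A b = N (J (i b))" using N_J_generator[of n] b nn by simp
      also have "N (J (i b)) \<le> N (J (i a)) + N (J (i (b \<ominus>\<^bsub>A\<^esub> a)))"
        using limsup_add[of "J (i a)" "J (i (b \<ominus>\<^bsub>A\<^esub> a))"] a b(1)
        by (simp add: bdd bdd_funs_diff J_diff)
      also have "N (J (i (b \<ominus>\<^bsub>A\<^esub> a))) \<le> nrm A (a \<ominus>\<^bsub>A\<^esub> b)"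
        using N_le[of "b \<ominus>\<^bsub>A\<^esub> a"] a b(1) by (simp add: A.nrm_diff_commute)
      finally show ?thesis using b(3) by simp
    qed
    then have "nrm A a \<le> N (J (i a))" by (rule field_le_epsilon)
    then show "N (J (i a)) = nrm A a" using N_le[OF a] by simp
  qed
qed

end

text \<open>A pair of functionals is encoded as one function on the disjoint union, so that the tree
  handles vectors of both lattices alike.\<close>

definition compatible :: "'e normed_lattice \<Rightarrow> 'a normed_lattice \<Rightarrow> 'b normed_lattice \<Rightarrow>
    ('e \<Rightarrow> 'a) \<Rightarrow> ('e \<Rightarrow> 'b) \<Rightarrow> ('a + 'b \<Rightarrow> real) set" where
  "compatible E A1 A2 f1 f2 = {\<Phi>. pos_fun A1 (\<lambda>x. \<Phi> (Inl x)) \<and> pos_fun A2 (\<lambda>x. \<Phi> (Inr x)) \<and>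
     (\<forall>e\<in>carrier E. \<Phi> (Inl (f1 e)) = \<Phi> (Inr (f2 e)))}"

lemma compatible_eq:
  "\<Phi> \<in> compatible E A1 A2 f1 f2 \<Longrightarrow> e \<in> carrier E \<Longrightarrow> \<Phi> (Inl (f1 e)) = \<Phi> (Inr (f2 e))"
  by (simp add: compatible_def)

lemma ex_functional_tree:
  fixes A1 :: "'a normed_lattice" and A2 :: "'b normed_lattice"
  assumes e1: "embedded E A1 f1" and e2: "embedded E A2 f2"
    and c: "\<And>n. c n \<in> carrier A1 <+> carrier A2"
  shows "\<exists>root. functional_tree (carrier A1 <+> carrier A2)
    (map_sum (pos_part A1) (pos_part A2)) (map_sum (modulus A1) (modulus A2))
    (compatible E A1 A2 f1 f2) c root (case_sum (nrm A1) (nrm A2))"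
proof -
  interpret e1: embedded E A1 f1 by (rule e1)
  interpret e2: embedded E A2 f2 by (rule e2)
  let ?X = "carrier A1 <+> carrier A2" and ?K = "compatible E A1 A2 f1 f2"
  let ?pos = "map_sum (pos_part A1) (pos_part A2)" and ?mod = "map_sum (modulus A1) (modulus A2)"
  let ?nn = "case_sum (nrm A1) (nrm A2)"
  have norming: "\<exists>\<Phi>\<in>?K. (\<forall>x\<in>?X. \<Phi> (?mod x) \<le> ?nn x) \<and> \<Phi> (?mod x) = ?nn x" if x: "x \<in> ?X" for x
  proof -
    have "\<exists>q1 q2. pos_fun A1 q1 \<and> pos_fun A2 q2 \<and> (\<forall>e\<in>carrier E. q1 (f1 e) = q2 (f2 e)) \<and>
        (\<forall>x\<in>carrier A1. q1 x \<le> nrm A1 x) \<and> (\<forall>x\<in>carrier A2. q2 x \<le> nrm A2 x) \<and>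
        case_sum q1 q2 (?mod x) = ?nn x"
    proof (cases x)
      case (Inl a)
      then show ?thesis using ex_compatible_norming[OF e1 e2, of a] x by auto
    next
      case (Inr b)
      \<comment> \<open>The existence lemma treats a vector of the first lattice; a vector of the
        second is reached by exchanging the embeddings.\<close>
      then obtain q1 q2 where "pos_fun A2 q1" "pos_fun A1 q2" "\<forall>e\<in>carrier E. q1 (f2 e) = q2 (f1 e)"
        "\<forall>x\<in>carrier A2. q1 x \<le> nrm A2 x" "\<forall>x\<in>carrier A1. q2 x \<le> nrm A1 x" "q1 (modulus A2 b) = nrm A2 b"
        using ex_compatible_norming[OF e2 e1, of b] x by auto
      then show ?thesis using Inr by (intro exI[of _ q2] exI[of _ q1]) auto
    qed
    then obtain q1 q2 where q: "pos_fun A1 q1" "pos_fun A2 q2" "\<forall>e\<in>carrier E. q1 (f1 e) = q2 (f2 e)"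
      "\<forall>x\<in>carrier A1. q1 x \<le> nrm A1 x" "\<forall>x\<in>carrier A2. q2 x \<le> nrm A2 x"
      "case_sum q1 q2 (?mod x) = ?nn x"
      by blast
    have "q1 (modulus A1 a) \<le> nrm A1 a" if "a \<in> carrier A1" for a
      using q(4) that e1.cod.nrm_modulus by (metis e1.cod.modulus_closed)
    moreover have "q2 (modulus A2 a) \<le> nrm A2 a" if "a \<in> carrier A2" for a
      using q(5) that e2.cod.nrm_modulus by (metis e2.cod.modulus_closed)
    ultimately show ?thesis
      using q by (intro bexI[of _ "case_sum q1 q2"]) (auto simp: compatible_def)
  qed
  have "\<forall>n. \<exists>\<Phi>. \<Phi> \<in> ?K \<and> (\<forall>x\<in>?X. \<Phi> (?mod x) \<le> ?nn x) \<and> \<Phi> (?mod (c n)) = ?nn (c n)"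
    using norming[OF c] by blast
  then obtain root where root: "\<And>n. root n \<in> ?K" "\<And>n x. x \<in> ?X \<Longrightarrow> root n (?mod x) \<le> ?nn x"
    "\<And>n. root n (?mod (c n)) = ?nn (c n)"
    by metis
  have "functional_tree ?X ?pos ?mod ?K c root ?nn"
  proof
    fix \<Phi> x assume Phi: "\<Phi> \<in> ?K" and x: "x \<in> ?X"
    have P: "pos_fun A1 (\<lambda>x. \<Phi> (Inl x))" "pos_fun A2 (\<lambda>x. \<Phi> (Inr x))"
      "\<And>e. e \<in> carrier E \<Longrightarrow> \<Phi> (Inl (f1 e)) = \<Phi> (Inr (f2 e))"
      using Phi by (auto simp: compatible_def)
    show "\<Phi> x \<le> \<Phi> (?pos x) \<and> 0 \<le> \<Phi> (?pos x)"
      using x e1.cod.pos_fun_pos_part[OF P(1)] e2.cod.pos_fun_pos_part[OF P(2)] by auto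
    show "\<Phi> (?mod x) = 2 * \<Phi> (?pos x) - \<Phi> x"
      using x e1.cod.pos_fun_modulus[OF P(1)] e2.cod.pos_fun_modulus[OF P(2)] by auto
    have "\<exists>q1 q2. pos_fun A1 q1 \<and> pos_fun A2 q2 \<and> pos_fun A1 (\<lambda>x. \<Phi> (Inl x) - q1 x) \<and>
        pos_fun A2 (\<lambda>x. \<Phi> (Inr x) - q2 x) \<and> (\<forall>e\<in>carrier E. q1 (f1 e) = q2 (f2 e)) \<and>
        case_sum q1 q2 x = \<Phi> (?pos x)"
    proof (cases x)
      case (Inl a)
      then show ?thesis using ex_compatible_split[OF e1 e2 P(1,2,3), of a] x by auto
    next
      case (Inr b)
      then obtain q1 q2 where "pos_fun A2 q1" "pos_fun A1 q2" "pos_fun A2 (\<lambda>x. \<Phi> (Inr x) - q1 x)"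
        "pos_fun A1 (\<lambda>x. \<Phi> (Inl x) - q2 x)" "\<forall>e\<in>carrier E. q1 (f2 e) = q2 (f1 e)"
        "q1 b = \<Phi> (Inr (pos_part A2 b))"
        using ex_compatible_split[OF e2 e1 P(2,1) P(3)[symmetric], of b] x by auto
      then show ?thesis using Inr by (intro exI[of _ q2] exI[of _ q1]) auto
    qed
    then obtain q1 q2 where q: "pos_fun A1 q1" "pos_fun A2 q2" "pos_fun A1 (\<lambda>x. \<Phi> (Inl x) - q1 x)"
      "pos_fun A2 (\<lambda>x. \<Phi> (Inr x) - q2 x)" "\<forall>e\<in>carrier E. q1 (f1 e) = q2 (f2 e)"
      "case_sum q1 q2 x = \<Phi> (?pos x)"
      by blast
    then show "\<exists>\<Psi>\<in>?K. (\<lambda>y. \<Phi> y - \<Psi> y) \<in> ?K \<and> \<Psi> x = \<Phi> (?pos x)"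
      using P(3) by (intro bexI[of _ "case_sum q1 q2"]) (auto simp: compatible_def)
  qed (use root c in auto)
  then show ?thesis by blast
qed

theorem theorem3p10:
  fixes E :: "'e normed_lattice"
    and A1 :: "'a normed_lattice"
    and A2 :: "'b normed_lattice"
    and f1 :: "'e \<Rightarrow> 'a"
    and f2 :: "'e \<Rightarrow> 'b"
  assumes "separable_banach_lattice E"
    and "separable_banach_lattice A1"
    and "separable_banach_lattice A2"
    and "lattice_embedding E A1 f1"
    and "lattice_embedding E A2 f2"
  shows "\<exists>(G :: (nat \<Rightarrow> real) normed_lattice) g1 g2.
      separable_banach_lattice G \<and>
      lattice_embedding A1 G g1 \<and>
      lattice_embedding A2 G g2 \<and>
      (\<forall>x\<in>carrier E. (g1 \<circ> f1) x = (g2 \<circ> f2) x)"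
proof -
  interpret E: separable_banach_lattice E by fact
  interpret A1: separable_banach_lattice A1 by fact
  interpret A2: separable_banach_lattice A2 by fact
  have e1: "embedded E A1 f1"
    by (intro embedded.intro embedded_axioms.intro assms E.normed_vector_lattice_axioms A1.normed_vector_lattice_axioms)
  have e2: "embedded E A2 f2"
    by (intro embedded.intro embedded_axioms.intro assms E.normed_vector_lattice_axioms A2.normed_vector_lattice_axioms)
  obtain D1 where D1: "D1 \<subseteq> carrier A1" "countable D1"
    "\<And>x e. x \<in> carrier A1 \<Longrightarrow> e > 0 \<Longrightarrow> \<exists>d\<in>D1. nrm A1 (x \<ominus>\<^bsub>A1\<^esub> d) < e"
    using A1.ex_countable_dense by blast
  obtain D2 where D2: "D2 \<subseteq> carrier A2" "countable D2"
    "\<And>x e. x \<in> carrier A2 \<Longrightarrow> e > 0 \<Longrightarrow> \<exists>d\<in>D2. nrm A2 (x \<ominus>\<^bsub>A2\<^esub> d) < e"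
    using A2.ex_countable_dense by blast
  \<comment> \<open>One enumeration of both dense sets: each pair of functionals is split along
    vectors of either lattice, and each of these vectors has a tree whose root norms it.\<close>
  define c where "c = from_nat_into (D1 <+> D2)"
  have D: "countable (D1 <+> D2)" using D1(2) D2(2) by (rule countable_Plus)
  have ne: "D1 <+> D2 \<noteq> {}" using D1(3)[OF A1.M.zero_closed, of 1] by auto
  have c: "c n \<in> carrier A1 <+> carrier A2" for n
    using from_nat_into[OF ne, of n] D1(1) D2(1) by (auto simp: c_def)
  have c_surj: "\<exists>n. c n = x" if "x \<in> D1 <+> D2" for x
    using from_nat_into_surj[OF D that] by (simp add: c_def)
  obtain root where "functional_tree (carrier A1 <+> carrier A2)
    (map_sum (pos_part A1) (pos_part A2)) (map_sum (modulus A1) (modulus A2))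
    (compatible E A1 A2 f1 f2) c root (case_sum (nrm A1) (nrm A2))"
    using ex_functional_tree[where c = c, OF e1 e2 c] by blast
  then interpret functional_tree "carrier A1 <+> carrier A2"
    "map_sum (pos_part A1) (pos_part A2)" "map_sum (modulus A1) (modulus A2)"
    "compatible E A1 A2 f1 f2" c root "case_sum (nrm A1) (nrm A2)" .
  have 1: "lattice_embedding A1 quot (\<lambda>a. rep (J (Inl a)))"
  proof (rule lattice_embedding_J[OF A1.normed_vector_lattice_axioms])
    fix a and e :: real assume a: "a \<in> carrier A1" "e > 0"
    then obtain d where d: "d \<in> D1" "nrm A1 (a \<ominus>\<^bsub>A1\<^esub> d) < e" using D1(3) by blast
    then obtain n where "c n = Inl d" using c_surj by blast
    then show "\<exists>b n. b \<in> carrier A1 \<and> c n = Inl b \<and> nrm A1 (a \<ominus>\<^bsub>A1\<^esub> b) < e"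
      using d D1(1) by blast
  qed (auto simp: compatible_def)
  have 2: "lattice_embedding A2 quot (\<lambda>a. rep (J (Inr a)))"
  proof (rule lattice_embedding_J[OF A2.normed_vector_lattice_axioms])
    fix a and e :: real assume a: "a \<in> carrier A2" "e > 0"
    then obtain d where d: "d \<in> D2" "nrm A2 (a \<ominus>\<^bsub>A2\<^esub> d) < e" using D2(3) by blast
    then obtain n where "c n = Inr d" using c_surj by blast
    then show "\<exists>b n. b \<in> carrier A2 \<and> c n = Inr b \<and> nrm A2 (a \<ominus>\<^bsub>A2\<^esub> b) < e"
      using d D2(1) by blast
  qed (auto simp: compatible_def)
  \<comment> \<open>The two functions agree at every node, before any passage to the quotient, since
    every node is a compatible pair.\<close>
  have eq: "J (Inl (f1 x)) = J (Inr (f2 x))" if "x \<in> carrier E" for x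
    using that by (auto simp: J_def compatible_eq[OF T_mem])
  \<comment> \<open>The quotient consists of functions on \<open>nat \<times> bool list\<close>; the
    required type is reached through an isomorphic copy.\<close>
  obtain G :: "(nat \<Rightarrow> real) normed_lattice" and h
    where G: "separable_banach_lattice G" "lattice_embedding quot G h"
    using ex_copy_nat_fun[OF separable_banach_lattice_quot] by blast
  show ?thesis
    using G lattice_embedding_comp[OF 1 G(2)] lattice_embedding_comp[OF 2 G(2)] eq
    by (intro exI[of _ G] exI[of _ "h \<circ> (\<lambda>a. rep (J (Inl a)))"] exI[of _ "h \<circ> (\<lambda>a. rep (J (Inr a)))"]) simp
qed

end
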